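(* Let $k \geq 3$ be an integer, let $Q_1, Q_2$ be positive definite quadratic forms in $k$ variables with integer coefficients, and set $\lambda_k = \frac{k}{2k+2}$. For a finitely supported function $f : \mathbb{Z}^{k+1} \to \mathbb{C}$ and $0<\lambda<1$ define $$ J_{Q_1,Q_2,\lambda} f(n,t) = \sum_{m \in \mathbb{Z}^k,\, m \neq 0} \frac{f(n-m,\, t - Q_1(m))}{Q_2(m)^{k\lambda/2}}, \qquad n \in \mathbb{Z}^k,\ t \in \mathbb{Z}. $$ Let $0 < \lambda \leq \lambda_k$ and $p,q \in [1,\infty]$. Then $J_{Q_1,Q_2,\lambda}$ extends to a bounded operator from $\ell^p(\mathbb{Z}^{k+1})$ to $\ell^q(\mathbb{Z}^{k+1})$ if $p,q$ satisfy both (i) $\frac{1}{q} < \frac{1}{p} - \left(1 - \frac{k+2}{k}\lambda\right)$, and (ii) $\frac{1}{q} < \lambda$ and $\frac{1}{p} > 1-\lambda$.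
   Context: Points of $\mathbb{Z}^{k+1}$ are written $(n,t)$ with $n\in\mathbb{Z}^k$, $t\in\mathbb{Z}$. "Extends to a bounded operator from $\ell^p$ to $\ell^q$" means that there is a constant $C$ (independent of $f$) with $\|J_{Q_1,Q_2,\lambda}f\|_{\ell^q}\le C\|f\|_{\ell^p}$ for all finitely supported $f$. Conventions: $1/\infty = 0$. *)

theory Defs
  imports "HOL-Analysis.Analysis"
begin

text \<open>
  An integer matrix \<open>A\<close> stands for the form \<open>Q(x) = \<Sum>\<^sub>i \<Sum>\<^sub>j A\<^sub>i\<^sub>j x\<^sub>i x\<^sub>j\<close>.  Symmetry of \<open>A\<close> is
  not required: the forms with integer coefficients are exactly those given by upper triangular
  integer matrices, whereas symmetric ones would force even cross coefficients.
\<close>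

definition quad_form :: "int ^ 'k ^ 'k \<Rightarrow> 'a::comm_ring_1 ^ 'k \<Rightarrow> 'a" where
  "quad_form A x = (\<Sum>i\<in>UNIV. \<Sum>j\<in>UNIV. of_int (A $ i $ j) * x $ i * x $ j)"

definition pos_def_form :: "int ^ 'k ^ 'k \<Rightarrow> bool" where
  "pos_def_form A \<longleftrightarrow> (\<forall>x :: real ^ 'k. x \<noteq> 0 \<longrightarrow> quad_form A x > 0)"

text \<open>The sum has only finitely many nonzero terms when \<open>f\<close> is finitely supported.\<close>

definition J :: "int ^ 'k ^ 'k \<Rightarrow> int ^ 'k ^ 'k \<Rightarrow> real \<Rightarrow>
    ((int ^ 'k) \<times> int \<Rightarrow> complex) \<Rightarrow> (int ^ 'k) \<times> int \<Rightarrow> complex" where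
  "J Q1 Q2 lam f = (\<lambda>(n, t). \<Sum>\<^sub>\<infinity>m\<in>{m. m \<noteq> 0}.
     f (n - m, t - quad_form Q1 m) /
       of_real (real_of_int (quad_form Q2 m) powr (real CARD('k) * lam / 2)))"

definition in_lp :: "ereal \<Rightarrow> ('a \<Rightarrow> complex) \<Rightarrow> bool" where
  "in_lp p f \<longleftrightarrow>
     (if p = \<infinity> then bounded (range f)
      else (\<lambda>x. norm (f x) powr real_of_ereal p) summable_on UNIV)"

text \<open>Meaningful only on functions satisfying \<open>in_lp p\<close>.\<close>

definition lp_norm :: "ereal \<Rightarrow> ('a \<Rightarrow> complex) \<Rightarrow> real" where
  "lp_norm p f =
     (if p = \<infinity> then (SUP x. norm (f x))
      else (\<Sum>\<^sub>\<infinity>x. norm (f x) powr real_of_ereal p) powr (1 / real_of_ereal p))"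

text \<open>
  As \<open>lp_norm\<close> is real-valued, finiteness of the norm of \<open>T f\<close> is stated separately.
\<close>

definition extends_to_bounded ::
  "ereal \<Rightarrow> ereal \<Rightarrow> (('a \<Rightarrow> complex) \<Rightarrow> 'b \<Rightarrow> complex) \<Rightarrow> bool" where
  "extends_to_bounded p q T \<longleftrightarrow>
     (\<exists>C. \<forall>f. finite {x. f x \<noteq> 0} \<longrightarrow> in_lp q (T f) \<and> lp_norm q (T f) \<le> C * lp_norm p f)"

end

theory Submission
  imports Defs
begin

text \<open>
  \<open>J\<close> has a nonnegative kernel, so all bounds reduce to counting incidences.  For finite sets \<open>E\<close>, \<open>F\<close> let
  \<open>I\<^sub>N(E,F)\<close> be the number of pairs in \<open>F \<times> E\<close> whose difference is \<open>(m, Q\<^sub>1(m))\<close> with \<open>m\<close> in the box of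
  radius \<open>N\<close>.  As \<open>Q\<^sub>2(m) \<ge> c |m|\<^sup>2\<close>, the kernel of \<open>J\<close> is dominated by the sum over \<open>N = 2\<^sup>j\<close> of
  \<open>N\<close> to the power \<open>- k \<lambda>\<close> times the indicator of the incidences at scale \<open>N\<close>.

  Three bounds for \<open>I\<^sub>N(E,F)\<close> are trivial: \<open>|E| |F|\<close>, \<open>O(N\<^sup>k |E|)\<close> and \<open>O(N\<^sup>k |F|)\<close>.  The fourth
  (\<open>incidences_critical\<close>) says, up to a factor \<open>N\<^sup>\<epsilon>\<close>, that \<open>I\<^sub>N(E,F)\<close> is at most \<open>N\<close> to the power
  \<open>2k/(k+4)\<close> times \<open>|E| |F|\<close> to the power \<open>(k+2)/(k+4)\<close>.  It comes from a version of the circle method.  A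
  Fourier transform in \<open>t\<close> (over \<open>\<int>/P\<close> with \<open>P\<close> huge, so that everything stays finite) turns the count
  into an average over frequencies \<open>r\<close> of bilinear forms given by convolution on \<open>\<int>\<^sup>k\<close> with the chirp
  \<open>m \<mapsto> e(r Q\<^sub>1(m) / P)\<close>, cut off smoothly to a box.  Up to a phase, the autocorrelation of a chirp is a linear
  exponential sum, since \<open>Q(m + h) - Q(m)\<close> is affine in \<open>m\<close>; so a \<open>TT\<^sup>*\<close> argument bounds the operator norm by
  \<open>W(r)\<close> to the power \<open>k/2\<close>, where \<open>W(r)\<close> is a sum of one-dimensional nonnegative kernels
  (\<open>chirp_form_bound\<close>).  The mean square of \<open>W\<close> counts solutions of \<open>ab + cd = 0\<close>, hence is small
  (\<open>kernel_sum_second_moment\<close>).  Frequencies with \<open>W(r) \<le> \<beta>\<close> are treated in \<open>\<ell>\<^sup>2\<close>; the few others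
  (the major arcs) trivially.  Balancing \<open>\<beta>\<close> gives the fourth bound.

  Taking weighted geometric means of the four bounds (\<open>incidences_restricted_bound\<close>) yields
  \<open>I\<^sub>N(E,F) = O(N\<^sup>\<mu> |E|\<^sup>x |F|\<^sup>z)\<close> whenever \<open>\<mu>\<close> exceeds \<open>k(1-x)\<close>, \<open>k(1-z)\<close> and \<open>k - (k+2)(x+z-1)\<close>.  With
  \<open>x\<close> near \<open>1/p\<close> and \<open>1 - z\<close> near \<open>1/q\<close> all three are below \<open>k \<lambda>\<close>: the first two by condition (ii), the last
  by condition (i) together with \<open>\<lambda> \<le> k/(2k+2)\<close>.  So the dyadic sum over \<open>N\<close> converges.  Since
  the conditions are strict, \<open>x < 1/p\<close> and \<open>z < 1 - 1/q\<close> can be arranged, and on a discrete space a restricted bound with such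
  exponents implies the \<open>\<ell>\<^sup>p\<close> to \<open>\<ell>\<^sup>q\<close> bound by cutting functions into dyadic levels
  (\<open>extends_to_bounded_if_restricted_bound\<close>).
\<close>

section \<open>Additive characters modulo \<open>P\<close>\<close>

definition echar :: "nat \<Rightarrow> int \<Rightarrow> complex" where
  "echar P x = cis (2 * pi * real_of_int x / real P)"

lemma echar_add: "echar P (x + y) = echar P x * echar P y"
  unfolding echar_def cis_mult by (simp add: add_divide_distrib distrib_left)

lemma echar_0 [simp]: "echar P 0 = 1"
  by (simp add: echar_def)

lemma norm_echar [simp]: "norm (echar P x) = 1"
  by (simp add: echar_def)

lemma cnj_echar: "cnj (echar P x) = echar P (- x)"
  by (simp add: echar_def cis_cnj)

lemma echar_diff: "echar P (x - y) = echar P x * cnj (echar P y)"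
  using echar_add[of P x "-y"] by (simp add: cnj_echar)

lemma echar_sum: "finite A \<Longrightarrow> echar P (\<Sum>i\<in>A. f i) = (\<Prod>i\<in>A. echar P (f i))"
  by (induction rule: finite_induct) (simp_all add: echar_add)

lemma echar_of_nat_mult: "echar P (int r * x) = echar P x ^ r"
  by (induction r) (simp_all add: echar_add algebra_simps)

lemma echar_orthogonality:
  assumes "P > 0"
  shows "(\<Sum>r<P. echar P (int r * x)) = (if int P dvd x then of_nat P else 0)"
proof (cases "int P dvd x")
  case True
  then obtain y where y: "x = int P * y" by (auto elim: dvdE)
  have "echar P x = 1"
  proof -
    have "2 * pi * real_of_int x / real P = 2 * pi * real_of_int y" using assms by (simp add: y)
    then show ?thesis unfolding echar_def by (simp only: cis_multiple_2pi Ints_of_int)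
  qed
  then show ?thesis using True by (simp add: echar_of_nat_mult)
next
  case False
  have "echar P x \<noteq> 1"
  proof
    assume "echar P x = 1"
    then have "cos (2 * pi * real_of_int x / real P) = 1"
      unfolding echar_def by (metis cis.simps(1) one_complex.simps(1))
    then obtain n :: int where n: "2 * pi * real_of_int x / real P = of_int n * 2 * pi"
      using cos_one_2pi_int by blast
    have "real_of_int x = of_int n * real P" using n assms by (simp add: field_simps)
    then have "x = n * int P" by (metis of_int_eq_iff of_int_mult of_int_of_nat_eq)
    then show False using False by simp
  qed
  moreover have "echar P x ^ P = 1"
  proof -
    have "2 * pi * real_of_int (int P * x) / real P = 2 * pi * real_of_int x" using assms by simp
    then have "echar P (int P * x) = 1"
      unfolding echar_def by (simp only: cis_multiple_2pi Ints_of_int)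
    then show ?thesis by (simp add: echar_of_nat_mult)
  qed
  ultimately show ?thesis using False
    by (simp add: echar_of_nat_mult sum_gp_strict)
qed

lemma echar_orthogonality_small:
  assumes "\<bar>x\<bar> < int P"
  shows "(\<Sum>r<P. echar P (int r * x)) = (if x = 0 then of_nat P else 0)"
proof -
  have "P > 0" using assms by linarith
  moreover have "int P dvd x \<longleftrightarrow> x = 0" using assms zdvd_imp_le[of "int P" "\<bar>x\<bar>"] by auto
  ultimately show ?thesis by (simp add: echar_orthogonality)
qed

section \<open>A triangle weight and its correlations\<close>

definition triangle :: "int \<Rightarrow> int \<Rightarrow> real" where
  "triangle L m = real_of_int (max 0 (L - \<bar>m\<bar>))"

lemma triangle_nonneg [simp]: "triangle L m \<ge> 0" by (simp add: triangle_def)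
lemma triangle_le: "L \<ge> 0 \<Longrightarrow> triangle L m \<le> real_of_int L" by (simp add: triangle_def)
lemma triangle_eq_0: "\<bar>m\<bar> \<ge> L \<Longrightarrow> triangle L m = 0" by (simp add: triangle_def)

lemma triangle_conv_sum:
  assumes "L \<ge> 0"
  shows "triangle L m = (\<Sum>d\<in>{0..<L}. of_bool (d + m \<in> {0..<L}))"
proof -
  have "(\<Sum>d\<in>{0..<L}. of_bool (d + m \<in> {0..<L})) = real (card {d\<in>{0..<L}. d + m \<in> {0..<L}})"
    by (simp add: Int_def)
  also have "{d\<in>{0..<L}. d + m \<in> {0..<L}} = {max 0 (- m)..<min L (L - m)}" by auto
  finally show ?thesis using assms by (auto simp add: triangle_def max_def min_def abs_if)
qed

lemma sum_of_bool_shift: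
  fixes g :: "int \<Rightarrow> complex"
  assumes "finite B" "\<And>a. a \<in> A \<Longrightarrow> a - d \<in> B" "finite A"
  shows "(\<Sum>m\<in>B. of_bool (d + m \<in> A) * g m) = (\<Sum>c\<in>A. g (c - d))"
proof -
  have "(\<Sum>m\<in>B. of_bool (d + m \<in> A) * g m) = (\<Sum>m\<in>{m\<in>B. d + m \<in> A}. g m)"
    using assms by (intro sum.mono_neutral_cong_right) auto
  also have "\<dots> = (\<Sum>c\<in>A. g (c - d))"
    by (rule sum.reindex_bij_witness[of _ "\<lambda>c. c - d" "\<lambda>m. d + m"]) (auto simp: assms)
  finally show ?thesis .
qed

definition triangle_sq_sum :: "nat \<Rightarrow> int \<Rightarrow> int \<Rightarrow> complex" where
  "triangle_sq_sum P L x = (\<Sum>m\<in>{-L..L}. of_real (triangle L m ^ 2) * echar P (m * x))"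

text \<open>
  With \<open>I = {0..<L}\<close>, the triangle weight counts the representations \<open>m = a - b\<close> with \<open>a, b \<in> I\<close>.  A product of two
  such weights therefore counts quadruples in \<open>I\<close>, and grouping them by the difference of the two subtracted elements
  exhibits the correlation as an inner product of two partial exponential sums over \<open>I \<inter> (I - s)\<close>.
\<close>

definition overlap_sum :: "nat \<Rightarrow> int \<Rightarrow> int \<Rightarrow> int \<Rightarrow> complex" where
  "overlap_sum P L x s = (\<Sum>c\<in>{0..<L}. of_bool (c + s \<in> {0..<L}) * echar P (c * x))"

lemma overlap_sum_eq_0: "s \<notin> {-L..L} \<Longrightarrow> overlap_sum P L x s = 0"
  unfolding overlap_sum_def by (intro sum.neutral) auto

text \<open>
  Substituting \<open>m = c - d\<close> and then \<open>b = d + s\<close>, with all of \<open>b, c, d\<close> in \<open>I\<close>, regroups the sum by \<open>s\<close>.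
\<close>

lemma triangle_correlation:
  assumes "L \<ge> 0"
  shows "(\<Sum>m\<in>{-L..L}. of_real (triangle L m * triangle L (m + h)) * echar P (m * x))
       = (\<Sum>s\<in>{-L..L}. overlap_sum P L x (s + h) * cnj (overlap_sum P L x s))"
proof -
  let ?I = "{0..<L}" and ?B = "{-L..L}"
  have tc: "complex_of_real (triangle L m) = (\<Sum>d\<in>?I. of_bool (d + m \<in> ?I))" for m
    by (simp add: triangle_conv_sum[OF assms] of_bool_def if_distrib cong: if_cong)
  have "(\<Sum>m\<in>?B. of_real (triangle L m * triangle L (m + h)) * echar P (m * x))
     = (\<Sum>m\<in>?B. \<Sum>d\<in>?I. of_bool (d + m \<in> ?I) * (of_real (triangle L (m + h)) * echar P (m * x)))"
    by (simp only: of_real_mult tc[of m for m] sum_distrib_right mult.assoc)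
  also have "\<dots> = (\<Sum>d\<in>?I. \<Sum>m\<in>?B. of_bool (d + m \<in> ?I) * (of_real (triangle L (m + h)) * echar P (m * x)))"
    by (rule sum.swap)
  also have "\<dots> = (\<Sum>d\<in>?I. \<Sum>c\<in>?I. of_real (triangle L (c - d + h)) * echar P ((c - d) * x))"
    by (intro sum.cong refl sum_of_bool_shift) auto
  also have "\<dots> = (\<Sum>d\<in>?I. \<Sum>c\<in>?I. \<Sum>s\<in>?B.
      (of_bool (c + (s + h) \<in> ?I) * echar P (c * x)) * (of_bool (d + s \<in> ?I) * cnj (echar P (d * x))))"
  proof (intro sum.cong refl)
    fix c d assume "c \<in> ?I" "d \<in> ?I"
    have "(\<Sum>s\<in>?B. of_bool (d + s \<in> ?I) * of_bool (c + (s + h) \<in> ?I))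
        = (\<Sum>b\<in>?I. of_bool (c + (b - d + h) \<in> ?I) :: complex)"
      using \<open>d \<in> ?I\<close> by (intro sum_of_bool_shift) auto
    also have "\<dots> = complex_of_real (triangle L (c - d + h))"
      unfolding tc by (intro sum.cong refl) (simp add: algebra_simps)
    finally have "complex_of_real (triangle L (c - d + h))
       = (\<Sum>s\<in>?B. of_bool (d + s \<in> ?I) * of_bool (c + (s + h) \<in> ?I))" ..
    then show "complex_of_real (triangle L (c - d + h)) * echar P ((c - d) * x) = (\<Sum>s\<in>?B.
      (of_bool (c + (s + h) \<in> ?I) * echar P (c * x)) * (of_bool (d + s \<in> ?I) * cnj (echar P (d * x))))"
      by (simp only: left_diff_distrib echar_diff sum_distrib_right) (simp only: mult_ac)
  qed
  also have "\<dots> = (\<Sum>d\<in>?I. \<Sum>s\<in>?B. \<Sum>c\<in>?I.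
      (of_bool (c + (s + h) \<in> ?I) * echar P (c * x)) * (of_bool (d + s \<in> ?I) * cnj (echar P (d * x))))"
    by (intro sum.cong refl sum.swap)
  also have "\<dots> = (\<Sum>s\<in>?B. \<Sum>d\<in>?I. \<Sum>c\<in>?I.
      (of_bool (c + (s + h) \<in> ?I) * echar P (c * x)) * (of_bool (d + s \<in> ?I) * cnj (echar P (d * x))))"
    by (rule sum.swap)
  also have "\<dots> = (\<Sum>s\<in>?B. overlap_sum P L x (s + h) * cnj (overlap_sum P L x s))"
  proof (intro sum.cong refl)
    fix s
    have b: "cnj (of_bool Q) = of_bool Q" for Q by (cases Q) simp_all
    show "(\<Sum>d\<in>?I. \<Sum>c\<in>?I.
      (of_bool (c + (s + h) \<in> ?I) * echar P (c * x)) * (of_bool (d + s \<in> ?I) * cnj (echar P (d * x))))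
      = overlap_sum P L x (s + h) * cnj (overlap_sum P L x s)"
      unfolding overlap_sum_def cnj_sum complex_cnj_mult b sum_product by (rule sum.swap)
  qed
  finally show ?thesis .
qed

lemma triangle_sq_sum_eq_norms:
  assumes "L \<ge> 0"
  shows "triangle_sq_sum P L x = of_real (\<Sum>s\<in>{-L..L}. norm (overlap_sum P L x s) ^ 2)"
proof -
  have "triangle_sq_sum P L x = (\<Sum>s\<in>{-L..L}. overlap_sum P L x s * cnj (overlap_sum P L x s))"
    using triangle_correlation[OF assms, of 0 P x] by (simp add: triangle_sq_sum_def power2_eq_square)
  then show ?thesis by (simp add: complex_norm_square[symmetric])
qed

lemma triangle_sq_sum_real: "L \<ge> 0 \<Longrightarrow> of_real (Re (triangle_sq_sum P L x)) = triangle_sq_sum P L x"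
  by (simp add: triangle_sq_sum_eq_norms)

lemma Re_triangle_sq_sum_nonneg: "L \<ge> 0 \<Longrightarrow> Re (triangle_sq_sum P L x) \<ge> 0"
  by (simp add: triangle_sq_sum_eq_norms sum_nonneg)

text \<open>
  By Cauchy-Schwarz, a shifted inner product of the partial sums is at most the unshifted one.  The gain over estimating
  a Dirichlet kernel is that the majorant is itself a trigonometric sum with nonnegative coefficients, so that its
  moments can be computed exactly.
\<close>

lemma norm_triangle_correlation_le:
  assumes "L \<ge> 0"
  shows "norm (\<Sum>m\<in>{-L..L}. of_real (triangle L m * triangle L (m + h)) * echar P (m * x)) \<le> Re (triangle_sq_sum P L x)"
proof -
  let ?B = "{-L..L}" and ?u = "overlap_sum P L x"
  have shift: "(\<Sum>s\<in>?B. norm (?u (s + h)) ^ 2) \<le> (\<Sum>s\<in>?B. norm (?u s) ^ 2)"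
  proof -
    have "(\<Sum>s\<in>?B. norm (?u (s + h)) ^ 2) = (\<Sum>s\<in>(\<lambda>s. s + h) ` ?B. norm (?u s) ^ 2)"
      by (subst sum.reindex) (auto simp: inj_on_def)
    also have "\<dots> = (\<Sum>s\<in>(\<lambda>s. s + h) ` ?B \<inter> ?B. norm (?u s) ^ 2)"
      by (intro sum.mono_neutral_right) (auto simp: overlap_sum_eq_0)
    also have "\<dots> \<le> (\<Sum>s\<in>?B. norm (?u s) ^ 2)" by (intro sum_mono2) auto
    finally show ?thesis .
  qed
  have "norm (\<Sum>s\<in>?B. ?u (s + h) * cnj (?u s)) \<le> (\<Sum>s\<in>?B. norm (?u (s + h)) * norm (?u s))"
    by (rule sum_norm_le) (simp add: norm_mult)
  also have "\<dots> \<le> (\<Sum>s\<in>?B. (norm (?u (s + h)) ^ 2 + norm (?u s) ^ 2) / 2)"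
  proof (rule sum_mono)
    fix s show "norm (?u (s + h)) * norm (?u s) \<le> (norm (?u (s + h)) ^ 2 + norm (?u s) ^ 2) / 2"
      using sum_squares_bound[of "norm (?u (s + h))" "norm (?u s)"] by simp
  qed
  also have "\<dots> \<le> (\<Sum>s\<in>?B. norm (?u s) ^ 2)"
    using shift by (simp add: sum_divide_distrib[symmetric] sum.distrib)
  finally show ?thesis
    by (simp only: triangle_correlation[OF assms] triangle_sq_sum_eq_norms[OF assms] Re_complex_of_real)
qed

section \<open>Counting solutions of \<open>ab + cd = 0\<close>\<close>

text \<open>
  Every solution of \<open>ab = cd\<close> has the form \<open>a = gx\<close>, \<open>b = ty\<close>, \<open>c = gy\<close>, \<open>d = tx\<close> with \<open>g = gcd a c\<close>.  For fixed \<open>x, y\<close>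
  both \<open>g\<close> and \<open>t\<close> are at most \<open>M / max x y\<close>, and the square of this is at most \<open>M\<^sup>2 / (xy)\<close>, whose sum factorises.
\<close>

lemma card_mult_eq_pos:
  "real (card {(a, b, c, d). a \<in> {1..M} \<and> b \<in> {1..M} \<and> c \<in> {1..M} \<and> d \<in> {1..M} \<and> a * b = c * (d::nat)})
     \<le> (real M * harm M) ^ 2" (is "real (card ?S) \<le> _")
proof -
  let ?T = "SIGMA xy:{1..M} \<times> {1..M}. {1..M div max (fst xy) (snd xy)} \<times> {1..M div max (fst xy) (snd xy)}"
  let ?h = "\<lambda>((x, y), (g, t)). (g * x, t * y, g * y, t * x) :: nat \<times> nat \<times> nat \<times> nat"
  have "?S \<subseteq> ?h ` ?T"
  proof safe
    fix a b c d assume r: "a \<in> {1..M}" "b \<in> {1..M}" "c \<in> {1..M}" "d \<in> {1..M}" and eq: "a * b = c * d"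
    define g where "g = gcd a c"
    have "g > 0" using r by (simp add: g_def)
    obtain x y where xy: "a = x * g" "c = y * g" "coprime x y"
      using gcd_coprime_exists[of a c] \<open>g > 0\<close> unfolding g_def by auto
    have e2: "x * b = y * d" using eq \<open>g > 0\<close> by (simp add: xy mult_ac)
    then have "y dvd x * b" by simp
    then have "y dvd b" using \<open>coprime x y\<close> by (metis coprime_commute coprime_dvd_mult_right_iff)
    then obtain t where t: "b = y * t" by (auto elim: dvdE)
    have "y > 0" using r by (auto simp: xy intro!: Nat.gr0I)
    have "x > 0" using r by (auto simp: xy intro!: Nat.gr0I)
    have d: "d = x * t" using e2 \<open>y > 0\<close> by (simp add: t)
    have "t > 0" using r by (auto simp: t intro!: Nat.gr0I)
    have xg: "x * g \<le> M" "y * g \<le> M" "x * t \<le> M" "y * t \<le> M" using r by (auto simp: xy t d)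
    have "g \<le> M div max x y" "t \<le> M div max x y"
      using \<open>x > 0\<close> \<open>y > 0\<close> xg by (auto simp: less_eq_div_iff_mult_less_eq max_def mult.commute)
    moreover have "x \<le> M" "y \<le> M"
      using xg \<open>g > 0\<close> by (meson le_trans mult_le_mono2 nat_mult_1_right Suc_leI dvd_imp_le dvd_triv_left mult_pos_pos \<open>x > 0\<close> \<open>y > 0\<close>)+
    ultimately have "((x, y), (g, t)) \<in> ?T"
      using \<open>x > 0\<close> \<open>y > 0\<close> \<open>g > 0\<close> \<open>t > 0\<close> by auto
    moreover have "(a, b, c, d) = ?h ((x, y), (g, t))" by (simp add: xy t d mult.commute)
    ultimately show "(a, b, c, d) \<in> ?h ` ?T" by (rule rev_image_eqI)
  qed
  moreover have "finite ?T" by (intro finite_SigmaI) auto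
  ultimately have "card ?S \<le> card ?T" by (rule surj_card_le[rotated])
  also have "card ?T = (\<Sum>xy\<in>{1..M} \<times> {1..M}. (M div max (fst xy) (snd xy)) ^ 2)"
    by (subst card_SigmaI) (auto simp: card_cartesian_product power2_eq_square)
  finally have "real (card ?S) \<le> (\<Sum>xy\<in>{1..M} \<times> {1..M}. real (M div max (fst xy) (snd xy)) ^ 2)"
    by (metis (mono_tags, lifting) of_nat_mono of_nat_power of_nat_sum sum.cong)
  also have "\<dots> \<le> (\<Sum>xy\<in>{1..M} \<times> {1..M}. (real M * inverse (real (fst xy))) * (real M * inverse (real (snd xy))))"
  proof (rule sum_mono)
    fix xy assume "xy \<in> {1..M} \<times> {1..M}"
    then obtain x y where xy: "xy = (x, y)" "x \<ge> 1" "y \<ge> 1" by auto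
    have "real (M div max x y) \<le> real M / real (max x y)" by (rule of_nat_div_le_of_nat)
    moreover have "real M / real (max x y) \<le> real M / real x" "real M / real (max x y) \<le> real M / real y"
      using xy by (auto intro!: divide_left_mono)
    ultimately show "real (M div max (fst xy) (snd xy)) ^ 2 \<le> (real M * inverse (real (fst xy))) * (real M * inverse (real (snd xy)))"
      unfolding xy power2_eq_square by (auto intro!: mult_mono simp: divide_inverse)
  qed
  also have "\<dots> = (\<Sum>x\<in>{1..M}. \<Sum>y\<in>{1..M}. (real M * inverse (real x)) * (real M * inverse (real y)))"
    by (simp only: sum.cartesian_product case_prod_unfold)
  also have "\<dots> = (real M * harm M) ^ 2"
  proof -
    have "real M * harm M = (\<Sum>x\<in>{1..M}. real M * inverse (real x))"
      by (simp add: harm_def sum_distrib_left)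
    then show ?thesis by (simp only: power2_eq_square sum_product)
  qed
  finally show ?thesis .
qed

text \<open>
  Solutions with \<open>ab = 0\<close> force \<open>cd = 0\<close> and are \<open>O(M\<^sup>2)\<close> in number; the others reduce to the positive case up to
  16 choices of signs.
\<close>

lemma card_mult_add_eq_0:
  assumes "M \<ge> 1"
  shows "real (card {(a, b, c, d). a \<in> {- int M..int M} \<and> b \<in> {- int M..int M} \<and> c \<in> {- int M..int M} \<and>
                         d \<in> {- int M..int M} \<and> a * b + c * d = 0})
     \<le> 52 * (real M * harm M) ^ 2" (is "real (card ?S) \<le> _")
proof -
  let ?B = "{- int M..int M}"
  let ?Z = "{0} \<times> ?B \<union> ?B \<times> {0}"
  let ?P = "{(a, b, c, d). a \<in> {1..M} \<and> b \<in> {1..M} \<and> c \<in> {1..M} \<and> d \<in> {1..M} \<and> a * b = c * (d::nat)}"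
  let ?E = "{-1, 1::int}"
  let ?h = "\<lambda>((e1, e2, e3, e4), (a, b, c, d)). (e1 * int a, e2 * int b, e3 * int c, e4 * int d)"
  let ?k = "\<lambda>((a, b), (c, d)). (a, b, c, d) :: int \<times> int \<times> int \<times> int"
  have sub: "?S \<subseteq> ?k ` (?Z \<times> ?Z) \<union> ?h ` ((?E \<times> ?E \<times> ?E \<times> ?E) \<times> ?P)"
  proof safe
    fix a b c d assume r: "a \<in> ?B" "b \<in> ?B" "c \<in> ?B" "d \<in> ?B" and eq: "a * b + c * d = 0"
      and n: "(a, b, c, d) \<notin> ?h ` ((?E \<times> ?E \<times> ?E \<times> ?E) \<times> ?P)"
    have nz: "a * b = 0"
    proof (rule ccontr)
      assume nz: "a * b \<noteq> 0"
      then have nz': "c * d \<noteq> 0" using eq by auto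
      have "int (nat \<bar>a\<bar> * nat \<bar>b\<bar>) = \<bar>a * b\<bar>" by (simp add: abs_mult)
      also have "\<dots> = \<bar>c * d\<bar>" using eq by linarith
      also have "\<dots> = int (nat \<bar>c\<bar> * nat \<bar>d\<bar>)" by (simp add: abs_mult)
      finally have "nat \<bar>a\<bar> * nat \<bar>b\<bar> = nat \<bar>c\<bar> * nat \<bar>d\<bar>" by (simp only: of_nat_eq_iff)
      then have "(nat \<bar>a\<bar>, nat \<bar>b\<bar>, nat \<bar>c\<bar>, nat \<bar>d\<bar>) \<in> ?P"
        using r nz nz' by (auto simp: nat_le_iff abs_le_iff Suc_le_eq)
      moreover have "(sgn a, sgn b, sgn c, sgn d) \<in> ?E \<times> ?E \<times> ?E \<times> ?E"
        using nz nz' by (auto simp: sgn_if)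
      moreover have "(a, b, c, d) = ?h ((sgn a, sgn b, sgn c, sgn d), (nat \<bar>a\<bar>, nat \<bar>b\<bar>, nat \<bar>c\<bar>, nat \<bar>d\<bar>))"
        by (simp add: sgn_mult_abs)
      ultimately show False using n by blast
    qed
    then have "c * d = 0" using eq by linarith
    with nz r have "(a, b) \<in> ?Z" "(c, d) \<in> ?Z" by auto
    then show "(a, b, c, d) \<in> ?k ` (?Z \<times> ?Z)" by force
  qed
  have fP: "finite ?P"
    by (rule finite_subset[of _ "{1..M} \<times> {1..M} \<times> {1..M} \<times> {1..M}"]) auto
  have cZ: "card ?Z \<le> 6 * M"
  proof -
    have "card ?Z \<le> card ({0::int} \<times> ?B) + card (?B \<times> {0::int})" by (rule card_Un_le)
    then show ?thesis using assms by (simp add: card_cartesian_product)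
  qed
  define Z P' E4 where "Z = ?Z" and "P' = ?P" and "E4 = ?E \<times> ?E \<times> ?E \<times> ?E"
  have cE: "card E4 = 16" "finite E4" by (simp_all add: E4_def card_cartesian_product)
  have fin: "finite Z" "finite P'" using fP by (simp_all add: Z_def P'_def)
  have "card ?S \<le> card (?k ` (Z \<times> Z) \<union> ?h ` (E4 \<times> P'))"
    by (rule card_mono[OF _ sub[folded Z_def P'_def E4_def]]) (use fin cE in simp)
  also have "\<dots> \<le> card (?k ` (Z \<times> Z)) + card (?h ` (E4 \<times> P'))" by (rule card_Un_le)
  also have "\<dots> \<le> card (Z \<times> Z) + card (E4 \<times> P')"
    by (intro add_mono card_image_le finite_cartesian_product fin cE)
  also have "\<dots> = card Z * card Z + 16 * card P'" by (simp add: card_cartesian_product cE)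
  also have "\<dots> \<le> (6 * M) * (6 * M) + 16 * card P'"
    using cZ unfolding Z_def[symmetric] by (intro add_right_mono mult_mono) simp_all
  finally have "real (card ?S) \<le> real ((6 * M) * (6 * M) + 16 * card P')" by (rule of_nat_mono)
  then have 1: "real (card ?S) \<le> 36 * real M ^ 2 + 16 * real (card P')"
    by (simp add: power2_eq_square)
  have "harm 1 \<le> (harm M :: real)" using assms by (rule harm_mono)
  then have "real M ^ 2 \<le> (real M * harm M) ^ 2"
    by (intro power_mono) (auto simp: harm_def mult_le_cancel_left1)
  then show ?thesis using 1 card_mult_eq_pos[of M] unfolding P'_def by linarith
qed

section \<open>The second moment of the kernel sum\<close>

text \<open>
  This is \<open>W(r)\<close>: its \<open>k\<close>-th power is the row sum in Schur's test for the squared \<open>k\<close>-dimensional operator at frequency \<open>r\<close>.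
\<close>

definition kernel_sum :: "nat \<Rightarrow> int \<Rightarrow> int \<Rightarrow> int \<Rightarrow> real" where
  "kernel_sum P L M r = (\<Sum>x\<in>{-M..M}. Re (triangle_sq_sum P L (r * x)))"

lemma kernel_sum_nonneg: "L \<ge> 0 \<Longrightarrow> kernel_sum P L M r \<ge> 0"
  unfolding kernel_sum_def by (intro sum_nonneg Re_triangle_sq_sum_nonneg)

text \<open>
  Expanding the square, orthogonality keeps only the terms with \<open>m x + m' x' = 0\<close>; for \<open>P > 2LM\<close> no other multiple of
  \<open>P\<close> can occur.
\<close>

lemma kernel_sum_second_moment:
  assumes "M \<ge> 1" "l \<le> M" "2 * int l * int M < int P"
  shows "(\<Sum>r<P. kernel_sum P (int l) (int M) (int r) ^ 2) \<le> real P * real l ^ 4 * (52 * (real M * harm M) ^ 2)"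
proof -
  let ?L = "int l" and ?N = "int M"
  let ?Q = "{-?L..?L} \<times> {-?N..?N}"
  define \<tau> where "\<tau> u = triangle ?L (fst u) ^ 2" for u :: "int \<times> int"
  define pr where "pr u = fst u * snd u" for u :: "int \<times> int"
  have W: "complex_of_real (kernel_sum P ?L ?N r) = (\<Sum>u\<in>?Q. of_real (\<tau> u) * echar P (r * pr u))" for r
  proof -
    have "complex_of_real (kernel_sum P ?L ?N r) = (\<Sum>x\<in>{-?N..?N}. triangle_sq_sum P ?L (r * x))"
      unfolding kernel_sum_def of_real_sum by (intro sum.cong refl triangle_sq_sum_real) simp
    also have "\<dots> = (\<Sum>x\<in>{-?N..?N}. \<Sum>m\<in>{-?L..?L}. of_real (\<tau> (m, x)) * echar P (r * pr (m, x)))"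
      unfolding triangle_sq_sum_def by (simp add: \<tau>_def pr_def mult_ac)
    also have "\<dots> = (\<Sum>u\<in>?Q. of_real (\<tau> u) * echar P (r * pr u))"
      by (subst sum.swap) (simp add: sum.cartesian_product case_prod_unfold)
    finally show ?thesis .
  qed
  have pr_le: "\<bar>pr u\<bar> \<le> ?L * ?N" if "u \<in> ?Q" for u
    unfolding pr_def abs_mult by (rule mult_mono) (use that in auto)
  have "complex_of_real (\<Sum>r<P. kernel_sum P ?L ?N (int r) ^ 2)
      = (\<Sum>r<P. \<Sum>u\<in>?Q. \<Sum>v\<in>?Q. of_real (\<tau> u * \<tau> v) * echar P (int r * (pr u + pr v)))"
    unfolding of_real_sum
  proof (intro sum.cong refl)
    fix r
    have "complex_of_real (kernel_sum P ?L ?N (int r) ^ 2)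
        = (\<Sum>u\<in>?Q. \<Sum>v\<in>?Q. (of_real (\<tau> u) * echar P (int r * pr u)) * (of_real (\<tau> v) * echar P (int r * pr v)))"
      by (simp only: power2_eq_square of_real_mult W sum_product)
    then show "complex_of_real (kernel_sum P ?L ?N (int r) ^ 2)
        = (\<Sum>u\<in>?Q. \<Sum>v\<in>?Q. of_real (\<tau> u * \<tau> v) * echar P (int r * (pr u + pr v)))"
      by (simp add: echar_add distrib_left mult_ac)
  qed
  also have "\<dots> = (\<Sum>u\<in>?Q. \<Sum>r<P. \<Sum>v\<in>?Q. of_real (\<tau> u * \<tau> v) * echar P (int r * (pr u + pr v)))"
    by (rule sum.swap)
  also have "\<dots> = (\<Sum>u\<in>?Q. \<Sum>v\<in>?Q. \<Sum>r<P. of_real (\<tau> u * \<tau> v) * echar P (int r * (pr u + pr v)))"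
    by (intro sum.cong refl sum.swap)
  also have "\<dots> = (\<Sum>u\<in>?Q. \<Sum>v\<in>?Q. of_real (\<tau> u * \<tau> v * (if pr u + pr v = 0 then real P else 0)))"
  proof (intro sum.cong refl)
    fix u v assume "u \<in> ?Q" "v \<in> ?Q"
    then have "\<bar>pr u + pr v\<bar> < int P"
      using pr_le[of u] pr_le[of v] assms(3) by (simp add: mult.assoc)
    then show "(\<Sum>r<P. of_real (\<tau> u * \<tau> v) * echar P (int r * (pr u + pr v)))
        = complex_of_real (\<tau> u * \<tau> v * (if pr u + pr v = 0 then real P else 0))"
      by (simp add: sum_distrib_left[symmetric] echar_orthogonality_small)
  qed
  finally have "(\<Sum>r<P. kernel_sum P ?L ?N (int r) ^ 2)
      = (\<Sum>u\<in>?Q. \<Sum>v\<in>?Q. \<tau> u * \<tau> v * (if pr u + pr v = 0 then real P else 0))"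
    unfolding of_real_sum[symmetric] of_real_eq_iff .
  also have "\<dots> \<le> (\<Sum>u\<in>?Q. \<Sum>v\<in>?Q. (if pr u + pr v = 0 then real l ^ 4 * real P else 0))"
  proof (intro sum_mono)
    fix u v
    have t: "\<tau> w \<le> real l ^ 2" "0 \<le> \<tau> w" for w
      unfolding \<tau>_def using triangle_le[of ?L "fst w"] by (auto intro!: power_mono)
    have "\<tau> u * \<tau> v \<le> real l ^ 2 * real l ^ 2" by (rule mult_mono) (use t in auto)
    then have "\<tau> u * \<tau> v \<le> real l ^ 4" by (simp flip: power_add)
    then show "\<tau> u * \<tau> v * (if pr u + pr v = 0 then real P else 0)
        \<le> (if pr u + pr v = 0 then real l ^ 4 * real P else 0)"
      by (auto intro: mult_right_mono)
  qed
  also have "\<dots> = real l ^ 4 * real P * real (card {w\<in>?Q \<times> ?Q. pr (fst w) + pr (snd w) = 0})"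
    by (simp only: sum.cartesian_product case_prod_unfold) (simp add: sum.If_cases Int_def)
  finally have 1: "(\<Sum>r<P. kernel_sum P ?L ?N (int r) ^ 2)
      \<le> real l ^ 4 * real P * real (card {w\<in>?Q \<times> ?Q. pr (fst w) + pr (snd w) = 0})" .
  have "card {w\<in>?Q \<times> ?Q. pr (fst w) + pr (snd w) = 0}
      \<le> card {(a, b, c, d). a \<in> {-?N..?N} \<and> b \<in> {-?N..?N} \<and> c \<in> {-?N..?N} \<and> d \<in> {-?N..?N} \<and> a * b + c * d = 0}"
    (is "card ?A \<le> card ?B")
  proof (rule card_inj_on_le)
    show "inj_on (\<lambda>((a, b), (c, d)). (a, b, c, d)) ?A" by (auto simp: inj_on_def)
    show "(\<lambda>((a, b), (c, d)). (a, b, c, d)) ` ?A \<subseteq> ?B" using assms(2) by (auto simp: pr_def)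
    show "finite ?B"
      by (rule finite_subset[of _ "{-?N..?N} \<times> {-?N..?N} \<times> {-?N..?N} \<times> {-?N..?N}"]) auto
  qed
  then have "real (card ?A) \<le> 52 * (real M * harm M) ^ 2"
    using card_mult_add_eq_0[OF assms(1)] by linarith
  then have "real l ^ 4 * real P * real (card ?A) \<le> real l ^ 4 * real P * (52 * (real M * harm M) ^ 2)"
    by (rule mult_left_mono) simp
  with 1 show ?thesis by (simp only: mult_ac)
qed

section \<open>Boxes, quadratic forms and polarisation\<close>

definition box :: "int \<Rightarrow> (int ^ 'k) set" where
  "box N = {m. \<forall>i. \<bar>m $ i\<bar> \<le> N}"

lemma bij_betw_vec_box:
  "bij_betw vec_lambda (PiE UNIV (\<lambda>i. {-N..N})) (box N :: (int ^ 'k) set)"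
  by (rule bij_betwI[where g = vec_nth]) (auto simp: box_def abs_le_iff minus_le_iff)

lemma finite_box: "finite (box N :: (int ^ 'k::finite) set)"
  using bij_betw_finite[OF bij_betw_vec_box[where 'k = 'k]] by (simp add: finite_PiE)

lemma sum_prod_box:
  fixes f :: "'k::finite \<Rightarrow> int \<Rightarrow> 'c::comm_semiring_1"
  shows "(\<Sum>m\<in>box N. \<Prod>i\<in>UNIV. f i (m $ i)) = (\<Prod>i\<in>UNIV. \<Sum>y\<in>{-N..N}. f i y)"
proof -
  have "(\<Sum>m\<in>box N. \<Prod>i\<in>UNIV. f i (m $ i)) = (\<Sum>g\<in>PiE UNIV (\<lambda>i. {-N..N}). \<Prod>i\<in>UNIV. f i (g i))"
    by (rule sum.reindex_bij_betw[OF bij_betw_vec_box, symmetric, THEN trans]) (simp add: vec_lambda_beta)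
  then show ?thesis by (simp add: prod_sum_PiE)
qed

definition box_weight :: "int \<Rightarrow> int ^ 'k::finite \<Rightarrow> real" where
  "box_weight L m = (\<Prod>i\<in>UNIV. triangle L (m $ i))"

lemma box_weight_nonneg: "box_weight L m \<ge> 0"
  unfolding box_weight_def by (intro prod_nonneg) simp

lemma box_weight_eq_0:
  assumes "m \<notin> box L"
  shows "box_weight L m = 0"
proof -
  obtain i where "\<bar>m $ i\<bar> > L" using assms by (auto simp: box_def not_le)
  then have "triangle L (m $ i) = 0" by (simp add: triangle_eq_0)
  then show ?thesis unfolding box_weight_def by (intro prod_zero) auto
qed

lemma box_weight_le:
  assumes "L \<ge> 0"
  shows "box_weight L (m :: int ^ 'k::finite) \<le> real_of_int L ^ CARD('k)"
proof -
  have "box_weight L m \<le> (\<Prod>i\<in>(UNIV :: 'k set). real_of_int L)"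
    unfolding box_weight_def by (intro prod_mono) (auto simp: triangle_le assms)
  then show ?thesis by simp
qed

lemma box_weight_ge:
  assumes "N \<ge> 0" "m \<in> box N"
  shows "box_weight (2 * N) (m :: int ^ 'k::finite) \<ge> real_of_int N ^ CARD('k)"
proof -
  have "(\<Prod>i\<in>(UNIV :: 'k set). real_of_int N) \<le> box_weight (2 * N) m"
    unfolding box_weight_def
  proof (intro prod_mono conjI)
    fix i show "0 \<le> real_of_int N" using assms by simp
    have "\<bar>m $ i\<bar> \<le> N" using assms(2) by (simp add: box_def)
    then show "real_of_int N \<le> triangle (2 * N) (m $ i)" by (simp add: triangle_def)
  qed
  then show ?thesis by simp
qed

lemma norm_box_weight_correlation_le:
  fixes h y :: "int ^ 'k::finite"
  assumes "L \<ge> 0"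
  shows "norm (\<Sum>m\<in>box L. of_real (box_weight L m * box_weight L (m + h)) * echar P (\<Sum>i\<in>UNIV. m $ i * y $ i))
     \<le> (\<Prod>i\<in>UNIV. Re (triangle_sq_sum P L (y $ i)))"
proof -
  have "(\<Sum>m\<in>box L. of_real (box_weight L m * box_weight L (m + h)) * echar P (\<Sum>i\<in>UNIV. m $ i * y $ i))
      = (\<Sum>m\<in>box L. \<Prod>i\<in>UNIV. of_real (triangle L (m $ i) * triangle L (m $ i + h $ i)) * echar P (m $ i * y $ i))"
    by (simp add: box_weight_def echar_sum prod.distrib)
  also have "\<dots> = (\<Prod>i\<in>UNIV. \<Sum>z\<in>{-L..L}. of_real (triangle L z * triangle L (z + h $ i)) * echar P (z * y $ i))"
    by (rule sum_prod_box)
  also have "norm \<dots> \<le> (\<Prod>i\<in>UNIV. Re (triangle_sq_sum P L (y $ i)))"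
    unfolding prod_norm[symmetric] by (intro prod_mono conjI norm_triangle_correlation_le assms) simp
  finally show ?thesis .
qed

text \<open>
  The majorants have product form, so a sum over a \<open>k\<close>-dimensional box is the \<open>k\<close>-th power of a one-dimensional sum.
\<close>

lemma sum_box_triangle_sq_sum:
  "(\<Sum>h\<in>(box M :: (int ^ 'k::finite) set). \<Prod>i\<in>UNIV. Re (triangle_sq_sum P L (r * h $ i))) = kernel_sum P L M r ^ CARD('k)"
  by (simp add: sum_prod_box[of "\<lambda>i y. Re (triangle_sq_sum P L (r * y))"] kernel_sum_def)

text \<open>
  The linear map \<open>h \<mapsto> (A + A\<^sup>T) h\<close>, which gives the linear part of \<open>Q(m + h) - Q(m)\<close> as a function of \<open>m\<close>.
\<close>

definition polar :: "int ^ 'k ^ 'k \<Rightarrow> int ^ 'k \<Rightarrow> int ^ 'k::finite" where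
  "polar A h = (\<chi> i. \<Sum>j\<in>UNIV. (A $ i $ j + A $ j $ i) * h $ j)"

lemma quad_form_add:
  fixes m h :: "int ^ 'k::finite"
  shows "quad_form A (m + h) = quad_form A m + quad_form A h + (\<Sum>i\<in>UNIV. m $ i * polar A h $ i)"
proof -
  have sw: "(\<Sum>i\<in>UNIV. \<Sum>j\<in>UNIV. m $ i * (A $ j $ i * h $ j)) = (\<Sum>i\<in>UNIV. \<Sum>j\<in>UNIV. A $ i $ j * h $ i * m $ j)"
    by (subst sum.swap) (simp add: mult_ac)
  show ?thesis
    by (simp add: quad_form_def polar_def distrib_left distrib_right sum.distrib sum_distrib_left sw)
       (simp add: mult_ac)
qed

lemma polar_diff: "polar A (h - h') = polar A h - polar A h'"
  by (simp add: polar_def vec_eq_iff right_diff_distrib sum_subtractf)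

lemma sum_mult_polar: "(\<Sum>i\<in>UNIV. h $ i * polar A h $ i) = 2 * quad_form A h"
proof -
  have "quad_form A (h + h) = 4 * quad_form A h"
    by (simp add: quad_form_def sum_distrib_left distrib_left distrib_right sum.distrib mult_ac)
  then show ?thesis using quad_form_add[of A h h] by simp
qed

lemma quad_form_real: "quad_form A (\<chi> i. real_of_int (m $ i)) = real_of_int (quad_form A m)"
  by (simp add: quad_form_def)

text \<open>
  The pairing of \<open>h\<close> with \<open>polar A h\<close> is \<open>2 Q(h)\<close>, which vanishes only at \<open>h = 0\<close>.
\<close>

lemma polar_inj:
  assumes "pos_def_form A"
  shows "inj (polar A)"
proof (rule injI)
  fix h h' assume "polar A h = polar A h'"
  then have "polar A (h - h') = 0" by (simp add: polar_diff)
  then have q: "quad_form A (h - h') = 0" using sum_mult_polar[of "h - h'" A] by simp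
  show "h = h'"
  proof (rule ccontr)
    assume "h \<noteq> h'"
    then have "(\<chi> i. real_of_int ((h - h') $ i)) \<noteq> 0" by (simp add: vec_eq_iff)
    then have "quad_form A (\<chi> i. real_of_int ((h - h') $ i)) > 0"
      using assms unfolding pos_def_form_def by blast
    then show False using q unfolding quad_form_real by simp
  qed
qed

lemma polar_bounded: "\<exists>D\<ge>1. \<forall>N. \<forall>h\<in>box N. polar (A :: int ^ 'k ^ 'k::finite) h \<in> box (int D * N)"
proof -
  define D where "D = nat (1 + (\<Sum>i\<in>UNIV. \<Sum>j\<in>UNIV. \<bar>A $ i $ j + A $ j $ i\<bar>))"
  have D: "int D = 1 + (\<Sum>i\<in>UNIV. \<Sum>j\<in>UNIV. \<bar>A $ i $ j + A $ j $ i\<bar>)"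
    unfolding D_def by (simp add: sum_nonneg add_nonneg_nonneg)
  have "0 \<le> (\<Sum>i\<in>UNIV. \<Sum>j\<in>UNIV. \<bar>A $ i $ j + A $ j $ i\<bar>)" by (simp add: sum_nonneg)
  then have D1: "D \<ge> 1" using D by linarith
  have "polar A h \<in> box (int D * N)" if h: "h \<in> box N" for N h
    unfolding box_def
  proof safe
    fix i
    have hN: "\<bar>h $ j\<bar> \<le> N" for j using h by (simp add: box_def)
    then have N0: "N \<ge> 0" by (meson abs_ge_zero order_trans)
    have "\<bar>polar A h $ i\<bar> \<le> (\<Sum>j\<in>UNIV. \<bar>(A $ i $ j + A $ j $ i) * h $ j\<bar>)"
      by (simp add: polar_def sum_abs)
    also have "\<dots> \<le> (\<Sum>j\<in>UNIV. \<bar>A $ i $ j + A $ j $ i\<bar> * N)"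
      by (intro sum_mono) (simp add: abs_mult hN mult_left_mono)
    also have "\<dots> = (\<Sum>j\<in>UNIV. \<bar>A $ i $ j + A $ j $ i\<bar>) * N" by (simp add: sum_distrib_right)
    also have "\<dots> \<le> int D * N"
    proof (rule mult_right_mono[OF _ N0])
      have "(\<Sum>j\<in>UNIV. \<bar>A $ i $ j + A $ j $ i\<bar>) \<le> (\<Sum>i\<in>UNIV. \<Sum>j\<in>UNIV. \<bar>A $ i $ j + A $ j $ i\<bar>)"
        by (rule member_le_sum[of i UNIV "\<lambda>i. \<Sum>j\<in>UNIV. \<bar>A $ i $ j + A $ j $ i\<bar>"]) (auto simp: sum_nonneg)
      then show "(\<Sum>j\<in>UNIV. \<bar>A $ i $ j + A $ j $ i\<bar>) \<le> int D" using D by linarith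
    qed
    finally show "\<bar>polar A h $ i\<bar> \<le> int D * N" .
  qed
  then show ?thesis using D1 by blast
qed

text \<open>
  By homogeneity, the minimum of the form on the unit sphere serves as \<open>c\<close>.
\<close>

lemma pos_def_form_lower_bound:
  assumes "pos_def_form (A :: int ^ 'k ^ 'k::finite)"
  shows "\<exists>c>0. \<forall>m i. c * real_of_int (m $ i) ^ 2 \<le> real_of_int (quad_form A m)"
proof -
  have cont: "continuous_on S (quad_form A :: real ^ 'k \<Rightarrow> real)" for S
    unfolding quad_form_def by (intro continuous_intros)
  have ne: "sphere (0 :: real ^ 'k) 1 \<noteq> {}" by simp
  obtain x0 :: "real ^ 'k" where x0: "x0 \<in> sphere 0 1" "\<forall>x\<in>sphere 0 1. quad_form A x0 \<le> quad_form A x"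
    using continuous_attains_inf[OF compact_sphere ne cont] by blast
  define c where "c = quad_form A x0"
  have "x0 \<noteq> 0" using x0(1) by auto
  then have "c > 0" using assms unfolding pos_def_form_def c_def by blast
  have scale: "quad_form A (s *\<^sub>R x) = s ^ 2 * quad_form A x" for s and x :: "real ^ 'k"
    by (simp add: quad_form_def sum_distrib_left power2_eq_square mult_ac)
  have low: "c * norm x ^ 2 \<le> quad_form A x" for x :: "real ^ 'k"
  proof (cases "x = 0")
    case True then show ?thesis by (simp add: quad_form_def)
  next
    case False
    have "c \<le> quad_form A ((1 / norm x) *\<^sub>R x)" unfolding c_def using x0(2) False by simp
    then show ?thesis using False by (simp add: scale field_simps)
  qed
  have "c * real_of_int (m $ i) ^ 2 \<le> real_of_int (quad_form A m)" for m :: "int ^ 'k" and i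
  proof -
    let ?x = "(\<chi> i. real_of_int (m $ i)) :: real ^ 'k"
    have "\<bar>real_of_int (m $ i)\<bar> \<le> norm ?x" using component_le_norm_cart[of ?x i] by simp
    then have "real_of_int (m $ i) ^ 2 \<le> norm ?x ^ 2" by (metis abs_ge_zero power2_abs power_mono)
    then have "c * real_of_int (m $ i) ^ 2 \<le> c * norm ?x ^ 2" using \<open>c > 0\<close> by simp
    also have "\<dots> \<le> quad_form A ?x" by (rule low)
    finally show ?thesis by (simp add: quad_form_real)
  qed
  then show ?thesis using \<open>c > 0\<close> by blast
qed

section \<open>Convolution operators bounded by their autocorrelation\<close>

lemma Cauchy_Schwarz_sum_sqrt:
  fixes a b :: "'a \<Rightarrow> real"
  shows "(\<Sum>i\<in>I. a i * b i) \<le> sqrt (\<Sum>i\<in>I. a i ^ 2) * sqrt (\<Sum>i\<in>I. b i ^ 2)"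
proof -
  have "(\<Sum>i\<in>I. a i * b i) \<le> sqrt ((\<Sum>i\<in>I. a i * b i)\<^sup>2)" by simp
  also have "\<dots> \<le> sqrt ((\<Sum>i\<in>I. a i ^ 2) * (\<Sum>i\<in>I. b i ^ 2))"
    by (intro real_sqrt_le_mono Cauchy_Schwarz_ineq_sum)
  finally show ?thesis by (simp add: real_sqrt_mult)
qed

lemma schur_test:
  fixes g :: "'a \<Rightarrow> real"
  assumes "\<And>p p'. p \<in> E \<Longrightarrow> p' \<in> E \<Longrightarrow> \<kappa> p p' = \<kappa> p' p" "\<And>p p'. \<kappa> p p' \<ge> 0"
    and "\<And>p. p \<in> E \<Longrightarrow> (\<Sum>p'\<in>E. \<kappa> p p') \<le> K"
  shows "(\<Sum>p\<in>E. \<Sum>p'\<in>E. g p * g p' * \<kappa> p p') \<le> K * (\<Sum>p\<in>E. g p ^ 2)"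
proof -
  have "(\<Sum>p\<in>E. \<Sum>p'\<in>E. g p * g p' * \<kappa> p p')
      \<le> (\<Sum>p\<in>E. \<Sum>p'\<in>E. g p ^ 2 * \<kappa> p p' / 2 + g p' ^ 2 * \<kappa> p p' / 2)"
  proof (intro sum_mono)
    fix p p'
    have "2 * (g p * g p') \<le> g p ^ 2 + g p' ^ 2" using sum_squares_bound[of "g p" "g p'"] by simp
    then have "2 * (g p * g p') * \<kappa> p p' \<le> (g p ^ 2 + g p' ^ 2) * \<kappa> p p'"
      by (intro mult_right_mono assms)
    then show "g p * g p' * \<kappa> p p' \<le> g p ^ 2 * \<kappa> p p' / 2 + g p' ^ 2 * \<kappa> p p' / 2"
      by (simp add: algebra_simps)
  qed
  also have "\<dots> = (\<Sum>p\<in>E. \<Sum>p'\<in>E. g p ^ 2 * \<kappa> p p') / 2 + (\<Sum>p\<in>E. \<Sum>p'\<in>E. g p' ^ 2 * \<kappa> p p') / 2"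
    by (simp add: sum.distrib sum_divide_distrib)
  also have "(\<Sum>p\<in>E. \<Sum>p'\<in>E. g p' ^ 2 * \<kappa> p p') = (\<Sum>p\<in>E. \<Sum>p'\<in>E. g p ^ 2 * \<kappa> p p')"
    by (subst sum.swap) (simp add: assms(1))
  also have "(\<Sum>p\<in>E. \<Sum>p'\<in>E. g p ^ 2 * \<kappa> p p') / 2 + (\<Sum>p\<in>E. \<Sum>p'\<in>E. g p ^ 2 * \<kappa> p p') / 2
      = (\<Sum>p\<in>E. g p ^ 2 * (\<Sum>p'\<in>E. \<kappa> p p'))"
    by (simp add: sum_distrib_left)
  also have "\<dots> \<le> (\<Sum>p\<in>E. g p ^ 2 * K)" by (intro sum_mono mult_left_mono assms) simp_all
  also have "\<dots> = K * (\<Sum>p\<in>E. g p ^ 2)" by (simp add: sum_distrib_left mult.commute)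
  finally show ?thesis .
qed

text \<open>
  This is the \<open>TT\<^sup>*\<close> method: the square of the convolution operator has the autocorrelation of \<open>a\<close> as its kernel, and Schur's
  test bounds it by row sums.
\<close>

lemma convolution_form_bound:
  fixes a g f :: "'v::ab_group_add \<Rightarrow> complex"
  assumes "finite S" "\<And>m. m \<notin> S \<Longrightarrow> a m = 0" "finite E" "finite F"
    and corr: "\<And>h. norm (\<Sum>m\<in>S. a m * cnj (a (m + h))) \<le> \<rho> h"
    and K: "\<And>p. p \<in> E \<Longrightarrow> (\<Sum>p'\<in>E. \<rho> (p - p')) \<le> K"
  shows "norm (\<Sum>n\<in>F. \<Sum>p\<in>E. a (n - p) * g p * f n)
     \<le> sqrt K * sqrt (\<Sum>p\<in>E. norm (g p) ^ 2) * sqrt (\<Sum>n\<in>F. norm (f n) ^ 2)"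
proof -
  define N where "N = F \<union> (\<lambda>(p, m). p + m) ` (E \<times> S)"
  have finN: "finite N" using assms by (simp add: N_def)
  define u where "u n = (\<Sum>p\<in>E. a (n - p) * g p)" for n
  define c where "c p p' = (\<Sum>n\<in>N. a (n - p) * cnj (a (n - p')))" for p p'
  have c_le: "norm (c p p') \<le> \<rho> (p - p')" if "p \<in> E" for p p'
  proof -
    have "c p p' = (\<Sum>n\<in>(\<lambda>m. p + m) ` S. a (n - p) * cnj (a (n - p')))"
      unfolding c_def
    proof (rule sum.mono_neutral_right[OF finN])
      show "(\<lambda>m. p + m) ` S \<subseteq> N" using that by (auto simp: N_def)
      show "\<forall>n\<in>N - (\<lambda>m. p + m) ` S. a (n - p) * cnj (a (n - p')) = 0"
      proof
        fix n assume "n \<in> N - (\<lambda>m. p + m) ` S"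
        moreover have "n = p + (n - p)" by simp
        ultimately have "n - p \<notin> S" by blast
        then show "a (n - p) * cnj (a (n - p')) = 0" using assms(2) by simp
      qed
    qed
    also have "\<dots> = (\<Sum>m\<in>S. a m * cnj (a (m + (p - p'))))"
      by (subst sum.reindex) (auto simp: inj_on_def algebra_simps)
    finally show ?thesis using corr by simp
  qed
  have "complex_of_real (\<Sum>n\<in>N. norm (u n) ^ 2) = (\<Sum>n\<in>N. u n * cnj (u n))"
    by (simp only: of_real_sum complex_norm_square)
  also have "\<dots> = (\<Sum>n\<in>N. \<Sum>p\<in>E. \<Sum>p'\<in>E. g p * cnj (g p') * (a (n - p) * cnj (a (n - p'))))"
    unfolding u_def cnj_sum sum_product by (intro sum.cong refl) (simp add: mult_ac)
  also have "\<dots> = (\<Sum>p\<in>E. \<Sum>n\<in>N. \<Sum>p'\<in>E. g p * cnj (g p') * (a (n - p) * cnj (a (n - p'))))"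
    by (rule sum.swap)
  also have "\<dots> = (\<Sum>p\<in>E. \<Sum>p'\<in>E. \<Sum>n\<in>N. g p * cnj (g p') * (a (n - p) * cnj (a (n - p'))))"
    by (intro sum.cong refl sum.swap)
  also have "\<dots> = (\<Sum>p\<in>E. \<Sum>p'\<in>E. g p * cnj (g p') * c p p')"
    by (simp add: c_def sum_distrib_left)
  finally have u2: "complex_of_real (\<Sum>n\<in>N. norm (u n) ^ 2) = (\<Sum>p\<in>E. \<Sum>p'\<in>E. g p * cnj (g p') * c p p')" .
  have "(\<Sum>n\<in>N. norm (u n) ^ 2) = norm (complex_of_real (\<Sum>n\<in>N. norm (u n) ^ 2))"
    by (simp only: norm_of_real abs_of_nonneg sum_nonneg zero_le_power2)
  also have "\<dots> \<le> (\<Sum>p\<in>E. \<Sum>p'\<in>E. norm (g p) * norm (g p') * norm (c p p'))"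
    unfolding u2 by (intro sum_norm_le) (simp add: norm_mult)
  also have "\<dots> \<le> K * (\<Sum>p\<in>E. norm (g p) ^ 2)"
  proof (rule schur_test)
    fix p p'
    have "c p' p = cnj (c p p')" by (simp add: c_def mult.commute)
    then show "norm (c p p') = norm (c p' p)" by simp
  next
    fix p assume "p \<in> E"
    then have "(\<Sum>p'\<in>E. norm (c p p')) \<le> (\<Sum>p'\<in>E. \<rho> (p - p'))" by (intro sum_mono c_le)
    also have "\<dots> \<le> K" using \<open>p \<in> E\<close> by (rule K)
    finally show "(\<Sum>p'\<in>E. norm (c p p')) \<le> K" .
  qed simp
  finally have uN: "(\<Sum>n\<in>N. norm (u n) ^ 2) \<le> K * (\<Sum>p\<in>E. norm (g p) ^ 2)" .
  have "norm (\<Sum>n\<in>F. \<Sum>p\<in>E. a (n - p) * g p * f n) = norm (\<Sum>n\<in>F. u n * f n)"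
    by (simp add: u_def sum_distrib_right)
  also have "\<dots> \<le> (\<Sum>n\<in>F. norm (u n) * norm (f n))" by (intro sum_norm_le) (simp add: norm_mult)
  also have "\<dots> \<le> sqrt (\<Sum>n\<in>F. norm (u n) ^ 2) * sqrt (\<Sum>n\<in>F. norm (f n) ^ 2)"
    by (rule Cauchy_Schwarz_sum_sqrt)
  also have "\<dots> \<le> sqrt (K * (\<Sum>p\<in>E. norm (g p) ^ 2)) * sqrt (\<Sum>n\<in>F. norm (f n) ^ 2)"
  proof (intro mult_right_mono real_sqrt_le_mono)
    have "(\<Sum>n\<in>F. norm (u n) ^ 2) \<le> (\<Sum>n\<in>N. norm (u n) ^ 2)"
      using finN by (intro sum_mono2) (auto simp: N_def)
    with uN show "(\<Sum>n\<in>F. norm (u n) ^ 2) \<le> K * (\<Sum>p\<in>E. norm (g p) ^ 2)" by simp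
  qed (simp add: sum_nonneg)
  finally show ?thesis by (simp add: real_sqrt_mult)
qed

section \<open>Incidences between points and translated paraboloids\<close>

text \<open>
  Parseval's identity in the last coordinate, on all fibres over the first coordinate at once.
\<close>

lemma mean_square_fibre_sums:
  fixes E :: "('v \<times> int) set"
  assumes "finite E" "\<And>w w'. w \<in> E \<Longrightarrow> w' \<in> E \<Longrightarrow> \<bar>snd w - snd w'\<bar> < int P"
  shows "(\<Sum>r<P. \<Sum>p\<in>fst ` E. norm (\<Sum>w\<in>{w\<in>E. fst w = p}. echar P (int r * snd w)) ^ 2) = real P * real (card E)"
proof -
  let ?Ep = "\<lambda>p. {w\<in>E. fst w = p}"
  have "complex_of_real (\<Sum>r<P. \<Sum>p\<in>fst ` E. norm (\<Sum>w\<in>?Ep p. echar P (int r * snd w)) ^ 2)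
      = (\<Sum>r<P. \<Sum>p\<in>fst ` E. \<Sum>w\<in>?Ep p. \<Sum>w'\<in>?Ep p. echar P (int r * (snd w - snd w')))"
    unfolding of_real_sum complex_norm_square cnj_sum sum_product
    by (simp add: echar_diff right_diff_distrib)
  also have "\<dots> = (\<Sum>p\<in>fst ` E. \<Sum>r<P. \<Sum>w\<in>?Ep p. \<Sum>w'\<in>?Ep p. echar P (int r * (snd w - snd w')))"
    by (rule sum.swap)
  also have "\<dots> = (\<Sum>p\<in>fst ` E. \<Sum>w\<in>?Ep p. \<Sum>r<P. \<Sum>w'\<in>?Ep p. echar P (int r * (snd w - snd w')))"
    by (intro sum.cong refl sum.swap)
  also have "\<dots> = (\<Sum>p\<in>fst ` E. \<Sum>w\<in>?Ep p. \<Sum>w'\<in>?Ep p. \<Sum>r<P. echar P (int r * (snd w - snd w')))"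
    by (intro sum.cong refl sum.swap)
  also have "\<dots> = (\<Sum>p\<in>fst ` E. \<Sum>w\<in>?Ep p. \<Sum>w'\<in>?Ep p. if w' = w then of_nat P else 0)"
  proof (intro sum.cong refl)
    fix p w w' assume w: "w \<in> ?Ep p" "w' \<in> ?Ep p"
    then have "snd w - snd w' = 0 \<longleftrightarrow> w' = w" by (auto simp: prod_eq_iff)
    then show "(\<Sum>r<P. echar P (int r * (snd w - snd w'))) = (if w' = w then of_nat P else 0)"
      using w assms(2)[of w w'] by (subst echar_orthogonality_small) auto
  qed
  also have "\<dots> = (\<Sum>p\<in>fst ` E. \<Sum>w\<in>?Ep p. of_nat P)"
    using assms(1) by (intro sum.cong refl) (subst sum.delta, auto)
  also have "\<dots> = (\<Sum>w\<in>E. of_nat P)"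
    using assms(1) by (intro sum.group) auto
  also have "\<dots> = complex_of_real (real P * real (card E))" by simp
  finally show ?thesis unfolding of_real_eq_iff .
qed

definition incidences :: "int ^ 'k ^ 'k \<Rightarrow> nat \<Rightarrow> ((int ^ 'k) \<times> int) set \<Rightarrow> ((int ^ 'k) \<times> int) set \<Rightarrow> nat" where
  "incidences A N E F = card {(v, w) \<in> F \<times> E. fst v - fst w \<in> box (int N) \<and>
      snd v - snd w = quad_form A (fst v - fst w)}"

definition chirp :: "int ^ 'k ^ 'k \<Rightarrow> nat \<Rightarrow> int \<Rightarrow> int \<Rightarrow> int ^ 'k::finite \<Rightarrow> complex" where
  "chirp A P L r m = of_real (box_weight L m) * echar P (r * quad_form A m)"

text \<open>
  The correlation of the chirp with its shift by \<open>h\<close> is a linear exponential sum with frequency \<open>r \<cdot> polar A h\<close>,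
  bounded by a product of one-dimensional majorants.  As \<open>polar A\<close> is injective, distinct shifts have distinct
  frequencies, so the row sum of Schur's test is at most the sum over all integer vectors of a larger box.
\<close>

lemma chirp_form_bound:
  fixes A :: "int ^ 'k ^ 'k::finite" and g f :: "int ^ 'k \<Rightarrow> complex"
  assumes inj: "inj (polar A)" and D: "\<And>h. h \<in> box (2 * L) \<Longrightarrow> polar A h \<in> box M"
    and "L \<ge> 0" "finite E" "finite F"
  shows "norm (\<Sum>n\<in>F. \<Sum>p\<in>E. chirp A P L r (n - p) * g p * f n)
     \<le> sqrt (kernel_sum P L M r ^ CARD('k)) * sqrt (\<Sum>p\<in>E. norm (g p) ^ 2) * sqrt (\<Sum>n\<in>F. norm (f n) ^ 2)"
proof (rule convolution_form_bound[of "box L"])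
  let ?G = "\<lambda>y :: int ^ 'k. \<Prod>i\<in>UNIV. Re (triangle_sq_sum P L (r * y $ i))"
  \<comment> \<open>The chirp is supported in the box of radius \<open>L\<close>, so only shifts of size at most \<open>2 L\<close> correlate.\<close>
  let ?\<rho> = "\<lambda>h. if h \<in> box (2 * L) then ?G (polar A h) else 0"
  have G0: "?G y \<ge> 0" for y by (intro prod_nonneg Re_triangle_sq_sum_nonneg \<open>L \<ge> 0\<close>)
  show "finite (box L :: (int ^ 'k) set)" by (rule finite_box)
  show "chirp A P L r m = 0" if "m \<notin> box L" for m using that by (simp add: chirp_def box_weight_eq_0)
  show "finite E" "finite F" by fact+
  show "norm (\<Sum>m\<in>box L. chirp A P L r m * cnj (chirp A P L r (m + h))) \<le> ?\<rho> h" for h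
  proof (cases "h \<in> box (2 * L)")
    case True
    have "norm (\<Sum>m\<in>box L. chirp A P L r m * cnj (chirp A P L r (m + h)))
        = norm (cnj (\<Sum>m\<in>box L. chirp A P L r m * cnj (chirp A P L r (m + h))))"
      by (rule complex_mod_cnj[symmetric])
    also have "cnj (\<Sum>m\<in>box L. chirp A P L r m * cnj (chirp A P L r (m + h)))
        = (\<Sum>m\<in>box L. echar P (r * quad_form A h) *
            (of_real (box_weight L m * box_weight L (m + h)) * echar P (\<Sum>i\<in>UNIV. m $ i * (r * polar A h $ i))))"
      unfolding cnj_sum
    proof (intro sum.cong refl)
      fix m
      have "r * quad_form A (m + h) - r * quad_form A m
          = r * quad_form A h + (\<Sum>i\<in>UNIV. m $ i * (r * polar A h $ i))"
        by (simp add: quad_form_add distrib_left sum_distrib_left mult_ac)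
      then have "echar P (r * quad_form A (m + h)) * cnj (echar P (r * quad_form A m))
          = echar P (r * quad_form A h) * echar P (\<Sum>i\<in>UNIV. m $ i * (r * polar A h $ i))"
        by (simp flip: echar_diff echar_add)
      then show "cnj (chirp A P L r m * cnj (chirp A P L r (m + h)))
         = echar P (r * quad_form A h) *
            (of_real (box_weight L m * box_weight L (m + h)) * echar P (\<Sum>i\<in>UNIV. m $ i * (r * polar A h $ i)))"
        by (simp add: chirp_def mult_ac)
    qed
    also have "norm \<dots> = norm (\<Sum>m\<in>box L. of_real (box_weight L m * box_weight L (m + h)) *
        echar P (\<Sum>i\<in>UNIV. m $ i * (\<chi> i. r * polar A h $ i) $ i))"
      unfolding sum_distrib_left[symmetric] norm_mult by simp
    also have "\<dots> \<le> (\<Prod>i\<in>UNIV. Re (triangle_sq_sum P L ((\<chi> i. r * polar A h $ i) $ i)))"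
      by (rule norm_box_weight_correlation_le) fact
    finally show ?thesis using True by simp
  next
    case False
    have "box_weight L (m + h) = 0" if "m \<in> box L" for m
    proof (rule box_weight_eq_0, rule notI)
      assume "m + h \<in> box L"
      have "\<bar>h $ i\<bar> \<le> 2 * L" for i
      proof -
        have "\<bar>m $ i\<bar> \<le> L" "\<bar>m $ i + h $ i\<bar> \<le> L"
          using that \<open>m + h \<in> box L\<close> unfolding box_def by auto
        then show ?thesis by linarith
      qed
      then show False using False by (simp add: box_def)
    qed
    then show ?thesis using False by (simp add: chirp_def)
  qed
  fix p
  have "(\<Sum>p'\<in>E. ?\<rho> (p - p')) = (\<Sum>h\<in>(\<lambda>p'. p - p') ` E. ?\<rho> h)"
    by (subst sum.reindex) (auto simp: inj_on_def)
  also have "\<dots> = (\<Sum>h\<in>(\<lambda>p'. p - p') ` E \<inter> box (2 * L). ?G (polar A h))"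
    using assms(4) by (simp add: sum.inter_restrict)
  also have "\<dots> = (\<Sum>y\<in>polar A ` ((\<lambda>p'. p - p') ` E \<inter> box (2 * L)). ?G y)"
    by (subst sum.reindex) (auto intro: inj_on_subset[OF inj])
  also have "\<dots> \<le> (\<Sum>y\<in>box M. ?G y)"
    by (intro sum_mono2 finite_box G0) (auto intro: D)
  also have "\<dots> = kernel_sum P L M r ^ CARD('k)" by (rule sum_box_triangle_sq_sum)
  finally show "(\<Sum>p'\<in>E. ?\<rho> (p - p')) \<le> kernel_sum P L M r ^ CARD('k)" .
qed

text \<open>
  The parameter \<open>\<beta>\<close> separates the frequencies.  Where the kernel sum is at most \<open>\<beta>\<close>, the \<open>\<ell>\<^sup>2\<close> bound applies and
  Parseval sums it over the frequencies; the remaining ones are few by Chebyshev's inequality and the second moment.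
\<close>

lemma incidences_two_term_bound:
  fixes A :: "int ^ 'k ^ 'k::finite" and E F :: "((int ^ 'k) \<times> int) set"
  assumes inj: "inj (polar A)" and D: "\<And>N h. h \<in> box N \<Longrightarrow> polar A h \<in> box (int D * N)" "D \<ge> 1"
    and "N \<ge> 1" "finite E" "finite F" "\<beta> > 0"
  defines "L \<equiv> 2 * N" and "M \<equiv> 4 * D * N"
  shows "real N ^ CARD('k) * real (incidences A N E F)
     \<le> \<beta> powr (real CARD('k) / 2) * sqrt (real (card E) * real (card F))
       + real L ^ CARD('k) * real (card E) * real (card F) * (real L ^ 4 * (52 * (real M * harm M) ^ 2) / \<beta> ^ 2)"
proof -
  let ?k = "CARD('k)"
  define Q :: "int ^ 'k \<Rightarrow> int" where "Q = quad_form A"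
  define G where "G = E \<union> F"
  define S where "S = (\<Sum>v\<in>G. \<Sum>w\<in>G. \<bar>Q (fst v - fst w) - (snd v - snd w)\<bar> + \<bar>snd v - snd w\<bar>)"
  \<comment> \<open>So large that every congruence modulo \<open>P\<close> used below is an equality of integers.\<close>
  define P where "P = nat (2 * int L * int M + S + 1)"
  have finG: "finite G" using assms by (simp add: G_def)
  have "S \<ge> 0" by (simp add: S_def sum_nonneg)
  then have P: "int P = 2 * int L * int M + S + 1" by (simp add: P_def)
  have P1: "2 * int L * int M < int P" using P \<open>S \<ge> 0\<close> by linarith
  have "0 \<le> 2 * int L * int M" by simp
  then have P0: "P > 0" using P1 by linarith
  have S_ge: "\<bar>Q (fst v - fst w) - (snd v - snd w)\<bar> + \<bar>snd v - snd w\<bar> \<le> S" if "v \<in> G" "w \<in> G" for v w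
  proof -
    have "\<bar>Q (fst v - fst w) - (snd v - snd w)\<bar> + \<bar>snd v - snd w\<bar>
        \<le> (\<Sum>w\<in>G. \<bar>Q (fst v - fst w) - (snd v - snd w)\<bar> + \<bar>snd v - snd w\<bar>)"
      by (rule member_le_sum[OF that(2)]) (auto simp: finG)
    also have "\<dots> \<le> S" unfolding S_def
      by (rule member_le_sum[OF that(1)]) (auto simp: finG sum_nonneg)
    finally show ?thesis .
  qed
  have LM: "2 * int L * int M \<ge> 0" by simp
  have P2: "\<bar>Q (fst v - fst w) - (snd v - snd w)\<bar> < int P" "\<bar>snd v - snd w\<bar> < int P"
    if "v \<in> G" "w \<in> G" for v w
    using S_ge[OF that] P LM by linarith+
  define g where "g r p = (\<Sum>w\<in>{w\<in>E. fst w = p}. echar P (int r * snd w))" for r :: nat and p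
  define f where "f r n = (\<Sum>v\<in>{v\<in>F. fst v = n}. cnj (echar P (int r * snd v)))" for r :: nat and n
  define B where "B r = (\<Sum>n\<in>fst ` F. \<Sum>p\<in>fst ` E. chirp A P (int L) (int r) (n - p) * g r p * f r n)" for r
  have B_eq: "B r = (\<Sum>v\<in>F. \<Sum>w\<in>E. of_real (box_weight (int L) (fst v - fst w)) *
      echar P (int r * (Q (fst v - fst w) - (snd v - snd w))))" for r
  proof -
    let ?t = "\<lambda>v w. chirp A P (int L) (int r) (fst v - fst w) * echar P (int r * snd w) * cnj (echar P (int r * snd v))"
    have "B r = (\<Sum>n\<in>fst ` F. \<Sum>p\<in>fst ` E. \<Sum>v\<in>{v\<in>F. fst v = n}. \<Sum>w\<in>{w\<in>E. fst w = p}. ?t v w)"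
      unfolding B_def
    proof (intro sum.cong refl)
      fix n p
      have "chirp A P (int L) (int r) (n - p) * g r p * f r n
          = f r n * (chirp A P (int L) (int r) (n - p) * g r p)" by (simp add: mult_ac)
      also have "\<dots> = (\<Sum>v\<in>{v\<in>F. fst v = n}. \<Sum>w\<in>{w\<in>E. fst w = p}. ?t v w)"
      proof -
        have "chirp A P (int L) (int r) (n - p) * g r p
            = (\<Sum>w\<in>{w\<in>E. fst w = p}. chirp A P (int L) (int r) (n - p) * echar P (int r * snd w))"
          by (simp add: g_def sum_distrib_left)
        then show ?thesis
          unfolding f_def by (simp only: sum_product) (intro sum.cong refl, auto simp: mult_ac)
      qed
      finally show "chirp A P (int L) (int r) (n - p) * g r p * f r n
          = (\<Sum>v\<in>{v\<in>F. fst v = n}. \<Sum>w\<in>{w\<in>E. fst w = p}. ?t v w)" .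
    qed
    also have "\<dots> = (\<Sum>n\<in>fst ` F. \<Sum>v\<in>{v\<in>F. fst v = n}. \<Sum>p\<in>fst ` E. \<Sum>w\<in>{w\<in>E. fst w = p}. ?t v w)"
      by (intro sum.cong refl sum.swap)
    also have "\<dots> = (\<Sum>n\<in>fst ` F. \<Sum>v\<in>{v\<in>F. fst v = n}. \<Sum>w\<in>E. ?t v w)"
      using assms by (intro sum.cong refl sum.group) auto
    also have "\<dots> = (\<Sum>v\<in>F. \<Sum>w\<in>E. ?t v w)"
      using assms by (intro sum.group) auto
    also have "\<dots> = (\<Sum>v\<in>F. \<Sum>w\<in>E. of_real (box_weight (int L) (fst v - fst w)) *
      echar P (int r * (Q (fst v - fst w) - (snd v - snd w))))"
    proof (intro sum.cong refl)
      fix v w :: "(int ^ 'k) \<times> int"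
      have "int r * (Q (fst v - fst w) - (snd v - snd w))
          = (int r * Q (fst v - fst w) + int r * snd w) - int r * snd v" by (simp add: algebra_simps)
      then have "echar P (int r * (Q (fst v - fst w) - (snd v - snd w)))
          = echar P (int r * Q (fst v - fst w)) * echar P (int r * snd w) * cnj (echar P (int r * snd v))"
        by (simp add: echar_diff echar_add)
      then show "?t v w = of_real (box_weight (int L) (fst v - fst w)) *
          echar P (int r * (Q (fst v - fst w) - (snd v - snd w)))"
        by (simp add: chirp_def Q_def)
    qed
    finally show ?thesis .
  qed
  have sumB: "(\<Sum>r<P. B r) = of_real (real P * (\<Sum>v\<in>F. \<Sum>w\<in>E. box_weight (int L) (fst v - fst w) *
      of_bool (snd v - snd w = Q (fst v - fst w))))"
  proof -
    have "(\<Sum>r<P. B r) = (\<Sum>v\<in>F. \<Sum>r<P. \<Sum>w\<in>E. of_real (box_weight (int L) (fst v - fst w)) *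
      echar P (int r * (Q (fst v - fst w) - (snd v - snd w))))"
      unfolding B_eq by (rule sum.swap)
    also have "\<dots> = (\<Sum>v\<in>F. \<Sum>w\<in>E. \<Sum>r<P. of_real (box_weight (int L) (fst v - fst w)) *
      echar P (int r * (Q (fst v - fst w) - (snd v - snd w))))"
      by (intro sum.cong refl sum.swap)
    also have "\<dots> = (\<Sum>v\<in>F. \<Sum>w\<in>E. of_real (real P * (box_weight (int L) (fst v - fst w) *
      of_bool (snd v - snd w = Q (fst v - fst w)))))"
    proof (intro sum.cong refl)
      fix v w assume "v \<in> F" "w \<in> E"
      then have "\<bar>Q (fst v - fst w) - (snd v - snd w)\<bar> < int P" by (intro P2) (auto simp: G_def)
      then show "(\<Sum>r<P. of_real (box_weight (int L) (fst v - fst w)) *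
            echar P (int r * (Q (fst v - fst w) - (snd v - snd w))))
          = complex_of_real (real P * (box_weight (int L) (fst v - fst w) * of_bool (snd v - snd w = Q (fst v - fst w))))"
        by (simp add: sum_distrib_left[symmetric] echar_orthogonality_small)
    qed
    finally show ?thesis by (simp add: sum_distrib_left)
  qed
  have lower: "real P * (real N ^ ?k * real (incidences A N E F)) \<le> norm (\<Sum>r<P. B r)"
  proof -
    let ?I = "{(v, w) \<in> F \<times> E. fst v - fst w \<in> box (int N) \<and> snd v - snd w = Q (fst v - fst w)}"
    have "real N ^ ?k * real (incidences A N E F) = (\<Sum>u\<in>?I. real N ^ ?k)"
      by (simp add: incidences_def Q_def mult.commute)
    also have "\<dots> \<le> (\<Sum>u\<in>?I. box_weight (int L) (fst (fst u) - fst (snd u)) *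
        of_bool (snd (fst u) - snd (snd u) = Q (fst (fst u) - fst (snd u))))"
    proof (rule sum_mono)
      fix u assume "u \<in> ?I"
      then show "real N ^ ?k \<le> box_weight (int L) (fst (fst u) - fst (snd u)) *
        of_bool (snd (fst u) - snd (snd u) = Q (fst (fst u) - fst (snd u)))"
        using box_weight_ge[of "int N" "fst (fst u) - fst (snd u)"] by (auto simp: L_def)
    qed
    also have "\<dots> \<le> (\<Sum>u\<in>F \<times> E. box_weight (int L) (fst (fst u) - fst (snd u)) *
        of_bool (snd (fst u) - snd (snd u) = Q (fst (fst u) - fst (snd u))))"
      using assms by (intro sum_mono2) (auto simp: box_weight_nonneg)
    also have "\<dots> = (\<Sum>v\<in>F. \<Sum>w\<in>E. box_weight (int L) (fst v - fst w) * of_bool (snd v - snd w = Q (fst v - fst w)))"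
      (is "_ = ?R") by (simp only: sum.cartesian_product case_prod_unfold)
    finally have "real P * (real N ^ ?k * real (incidences A N E F)) \<le> real P * ?R" by (intro mult_left_mono) simp_all
    also have "\<dots> \<le> norm (\<Sum>r<P. B r)" unfolding sumB norm_of_real by simp
    finally show ?thesis .
  qed
  have boxL: "polar A h \<in> box (int M)" if "h \<in> box (2 * int L)" for h
    using D(1)[OF that] by (simp add: M_def L_def mult_ac)
  let ?W = "\<lambda>r. kernel_sum P (int L) (int M) (int r)"
  let ?g2 = "\<lambda>r. \<Sum>p\<in>fst ` E. norm (g r p) ^ 2" and ?f2 = "\<lambda>r. \<Sum>n\<in>fst ` F. norm (f r n) ^ 2"
  have B1: "norm (B r) \<le> sqrt (?W r ^ ?k) * sqrt (?g2 r) * sqrt (?f2 r)" for r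
    unfolding B_def using assms by (intro chirp_form_bound inj boxL) auto
  have B2: "norm (B r) \<le> real L ^ ?k * real (card E) * real (card F)" for r
  proof -
    have "norm (B r) \<le> (\<Sum>v\<in>F. \<Sum>w\<in>E. real L ^ ?k)"
      unfolding B_eq
    proof (intro sum_norm_le)
      fix v w :: "(int ^ 'k) \<times> int"
      have "box_weight (int L) (fst v - fst w) \<le> real L ^ ?k"
        using box_weight_le[of "int L" "fst v - fst w"] by simp
      then show "norm (complex_of_real (box_weight (int L) (fst v - fst w)) *
            echar P (int r * (Q (fst v - fst w) - (snd v - snd w)))) \<le> real L ^ ?k"
        by (simp add: norm_mult box_weight_nonneg)
    qed
    then show ?thesis by (simp add: mult_ac)
  qed
  have sum_g: "(\<Sum>r<P. ?g2 r) = real P * real (card E)"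
    unfolding g_def using assms by (intro mean_square_fibre_sums P2) (auto simp: G_def)
  have "(\<Sum>r<P. \<Sum>n\<in>fst ` F. norm (\<Sum>v\<in>{v\<in>F. fst v = n}. echar P (int r * snd v)) ^ 2) = real P * real (card F)"
    using assms by (intro mean_square_fibre_sums P2) (auto simp: G_def)
  then have sum_f: "(\<Sum>r<P. ?f2 r) = real P * real (card F)"
    unfolding f_def cnj_sum[symmetric] complex_mod_cnj .
  \<comment> \<open>the major arcs\<close>
  define R2 where "R2 = {r\<in>{..<P}. ?W r > \<beta>}"
  have W0: "?W r \<ge> 0" for r by (intro kernel_sum_nonneg) simp
  have cardR2: "real (card R2) \<le> real P * real L ^ 4 * (52 * (real M * harm M) ^ 2) / \<beta> ^ 2"
  proof -
    have "real (card R2) * \<beta> ^ 2 = (\<Sum>r\<in>R2. \<beta> ^ 2)" by simp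
    also have "\<dots> \<le> (\<Sum>r\<in>R2. ?W r ^ 2)"
      using \<open>\<beta> > 0\<close> by (intro sum_mono power_mono) (auto simp: R2_def)
    also have "\<dots> \<le> (\<Sum>r<P. ?W r ^ 2)" by (intro sum_mono2) (auto simp: R2_def)
    also have "\<dots> \<le> real P * real L ^ 4 * (52 * (real M * harm M) ^ 2)"
    proof (rule kernel_sum_second_moment[OF _ _ P1])
      show "1 \<le> M" using \<open>N \<ge> 1\<close> \<open>D \<ge> 1\<close> by (simp add: M_def)
      have "2 * N \<le> 4 * D * N" using \<open>D \<ge> 1\<close> by (intro mult_right_mono) simp_all
      then show "L \<le> M" by (simp add: L_def M_def)
    qed
    finally show ?thesis using \<open>\<beta> > 0\<close> by (simp add: field_simps)
  qed
  have "norm (\<Sum>r<P. B r) \<le> (\<Sum>r<P. norm (B r))" by (rule norm_sum)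
  also have "\<dots> = (\<Sum>r\<in>{..<P} - R2. norm (B r)) + (\<Sum>r\<in>R2. norm (B r))"
    by (rule sum.subset_diff) (auto simp: R2_def)
  also have "(\<Sum>r\<in>R2. norm (B r)) \<le> real (card R2) * (real L ^ ?k * real (card E) * real (card F))"
    using sum_mono[of R2 "\<lambda>r. norm (B r)" "\<lambda>r. real L ^ ?k * real (card E) * real (card F)"] B2 by simp
  also have "(\<Sum>r\<in>{..<P} - R2. norm (B r)) \<le> \<beta> powr (real ?k / 2) * (real P * sqrt (real (card E) * real (card F)))"
  proof -
    have "(\<Sum>r\<in>{..<P} - R2. norm (B r))
        \<le> (\<Sum>r\<in>{..<P} - R2. \<beta> powr (real ?k / 2) * (sqrt (?g2 r) * sqrt (?f2 r)))"
    proof (rule sum_mono)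
      fix r assume "r \<in> {..<P} - R2"
      then have "?W r \<le> \<beta>" by (auto simp: R2_def)
      then have "sqrt (?W r ^ ?k) \<le> sqrt (\<beta> ^ ?k)" by (intro real_sqrt_le_mono power_mono W0)
      also have "sqrt (\<beta> ^ ?k) = \<beta> powr (real ?k / 2)"
        using \<open>\<beta> > 0\<close> by (simp add: powr_half_sqrt[symmetric] powr_realpow[symmetric] powr_powr)
      finally have "sqrt (?W r ^ ?k) * (sqrt (?g2 r) * sqrt (?f2 r))
         \<le> \<beta> powr (real ?k / 2) * (sqrt (?g2 r) * sqrt (?f2 r))"
        by (intro mult_right_mono) (simp_all add: sum_nonneg)
      then show "norm (B r) \<le> \<beta> powr (real ?k / 2) * (sqrt (?g2 r) * sqrt (?f2 r))"
        using B1[of r] by (simp add: mult.assoc)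
    qed
    also have "\<dots> \<le> (\<Sum>r<P. \<beta> powr (real ?k / 2) * (sqrt (?g2 r) * sqrt (?f2 r)))"
      by (intro sum_mono2) (auto simp: sum_nonneg)
    also have "\<dots> = \<beta> powr (real ?k / 2) * (\<Sum>r<P. sqrt (?g2 r) * sqrt (?f2 r))"
      by (simp add: sum_distrib_left)
    also have "\<dots> \<le> \<beta> powr (real ?k / 2) * (sqrt (\<Sum>r<P. sqrt (?g2 r) ^ 2) * sqrt (\<Sum>r<P. sqrt (?f2 r) ^ 2))"
      by (intro mult_left_mono Cauchy_Schwarz_sum_sqrt) simp
    also have "sqrt (\<Sum>r<P. sqrt (?g2 r) ^ 2) * sqrt (\<Sum>r<P. sqrt (?f2 r) ^ 2)
        = sqrt (real P * real (card E)) * sqrt (real P * real (card F))"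
      by (simp add: sum_nonneg sum_g sum_f)
    also have "\<dots> = real P * sqrt (real (card E) * real (card F))"
      by (simp add: real_sqrt_mult)
    finally show ?thesis .
  qed
  finally have "norm (\<Sum>r<P. B r) \<le> \<beta> powr (real ?k / 2) * (real P * sqrt (real (card E) * real (card F)))
      + real (card R2) * (real L ^ ?k * real (card E) * real (card F))" by simp
  moreover have "real (card R2) * (real L ^ ?k * real (card E) * real (card F))
     \<le> real P * real L ^ 4 * (52 * (real M * harm M) ^ 2) / \<beta> ^ 2 * (real L ^ ?k * real (card E) * real (card F))"
    by (intro mult_right_mono cardR2) simp
  ultimately have "real P * (real N ^ ?k * real (incidences A N E F))
     \<le> \<beta> powr (real ?k / 2) * (real P * sqrt (real (card E) * real (card F)))
      + real P * real L ^ 4 * (52 * (real M * harm M) ^ 2) / \<beta> ^ 2 * (real L ^ ?k * real (card E) * real (card F))"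
    using lower by linarith
  also have "\<dots> = real P * (\<beta> powr (real ?k / 2) * sqrt (real (card E) * real (card F))
       + real L ^ ?k * real (card E) * real (card F) * (real L ^ 4 * (52 * (real M * harm M) ^ 2) / \<beta> ^ 2))"
    by (simp add: distrib_left mult_ac)
  finally show ?thesis using P0 by simp
qed

lemma harm_le_1_plus_ln: "n \<ge> 1 \<Longrightarrow> harm n \<le> 1 + ln (real n)"
proof -
  assume "n \<ge> 1"
  then obtain m where m: "n = Suc m" by (cases n) auto
  have "harm (Suc m) - ln (real (Suc m)) \<le> harm (Suc 0) - ln (real (Suc 0))"
    using decseqD[OF decseq_harm_diff_ln, of 0 m] by simp
  then show ?thesis by (simp add: m harm_expand)
qed

lemma harm_le_powr:
  assumes "\<epsilon> > 0" "n \<ge> 1"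
  shows "harm n \<le> (1 + 1 / \<epsilon>) * real n powr \<epsilon>"
proof -
  have "1 \<le> real n powr \<epsilon>" using assms by (simp add: ge_one_powr_ge_zero)
  moreover have "ln (real n) \<le> real n powr \<epsilon> / \<epsilon>" using assms by (intro ln_powr_bound) auto
  ultimately show ?thesis using harm_le_1_plus_ln[OF assms(2)] by (simp add: algebra_simps)
qed

lemma incidences_empty [simp]: "incidences A N {} F = 0" "incidences A N E {} = 0"
  by (simp_all add: incidences_def)

text \<open>
  The right choice of \<open>\<beta> = N\<^sup>2 \<alpha>\<close> makes the two terms of \<open>incidences_two_term_bound\<close> equal up to constants.
\<close>

lemma incidences_critical_harm:
  fixes A :: "int ^ 'k ^ 'k::finite" and E F :: "((int ^ 'k) \<times> int) set"
  assumes inj: "inj (polar A)" and D: "\<And>N h. h \<in> box N \<Longrightarrow> polar A h \<in> box (int D * N)" "D \<ge> 1"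
    and "N \<ge> 1" "finite E" "finite F" "E \<noteq> {}" "F \<noteq> {}"
  defines "k \<equiv> real CARD('k)"
  shows "real (incidences A N E F) \<le> (1 + 2 ^ CARD('k) * 13312 * real D ^ 2) *
     (real N ^ 2 * harm (4 * D * N) ^ 2) powr (k / (k + 4)) * (real (card E) * real (card F)) powr ((k + 2) / (k + 4))"
proof -
  define R where "R = sqrt (real (card E) * real (card F))"
  define h :: real where "h = harm (4 * D * N)"
  define T where "T = real N ^ 2 * h ^ 2"
  define u where "u = k / (k + 4)"
  \<comment> \<open>The solution of \<open>\<alpha> powr (k / 2) * R = T * R\<^sup>2 / \<alpha>\<^sup>2\<close>.\<close>
  define \<alpha> where "\<alpha> = (T * R) powr (2 / (k + 4))"
  have k: "k > 0" by (simp add: k_def)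
  have ef: "real (card E) * real (card F) > 0" using assms by (simp add: card_gt_0_iff)
  then have R: "R > 0" "R ^ 2 = real (card E) * real (card F)" by (simp_all add: R_def)
  have h: "h > 0" using assms by (simp add: h_def)
  have N: "real N > 0" using assms by simp
  have T: "T > 0" using h N by (simp add: T_def)
  have TR: "T * R > 0" using T R by simp
  have \<alpha>: "\<alpha> > 0" unfolding \<alpha>_def using T R by simp
  have "real N ^ CARD('k) * real (incidences A N E F) \<le> (real N ^ 2 * \<alpha>) powr (k / 2) * R
      + real (2 * N) ^ CARD('k) * real (card E) * real (card F) *
        (real (2 * N) ^ 4 * (52 * (real (4 * D * N) * h) ^ 2) / (real N ^ 2 * \<alpha>) ^ 2)"
    unfolding R_def k_def h_def
    by (rule incidences_two_term_bound[OF inj D]) (use assms \<alpha> in auto)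
  also have "(real N ^ 2 * \<alpha>) powr (k / 2) = real N ^ CARD('k) * \<alpha> powr (k / 2)"
  proof -
    have "(real N ^ 2) powr (k / 2) = (real N powr 2) powr (k / 2)" using N by simp
    also have "\<dots> = real N powr k" by (simp only: powr_powr) simp
    also have "\<dots> = real N ^ CARD('k)" unfolding k_def by (rule powr_realpow[OF N])
    finally have "(real N ^ 2) powr (k / 2) = real N ^ CARD('k)" .
    then show ?thesis using N \<alpha> by (simp add: powr_mult)
  qed
  also have "\<alpha> powr (k / 2) = (T * R) powr u"
  proof -
    have "2 / (k + 4) * (k / 2) = u" using k by (simp add: u_def field_simps)
    then show ?thesis by (simp only: \<alpha>_def powr_powr)
  qed
  also have "real (2 * N) ^ CARD('k) * real (card E) * real (card F) *
        (real (2 * N) ^ 4 * (52 * (real (4 * D * N) * h) ^ 2) / (real N ^ 2 * \<alpha>) ^ 2)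
      = real N ^ CARD('k) * (2 ^ CARD('k) * 13312 * real D ^ 2 * (R * (T * R / \<alpha> ^ 2)))"
  proof -
    have scaling: "(2 * x) ^ 4 * (52 * ((4 * d * x) * h) ^ 2) / (x ^ 2 * \<alpha>) ^ 2
        = 13312 * d ^ 2 * (x ^ 2 * h ^ 2 / \<alpha> ^ 2)" if "x \<noteq> 0" for x d :: real
      using that \<alpha> by (simp add: power_mult_distrib power_mult[symmetric] field_simps)
    have "real (2 * N) ^ 4 * (52 * (real (4 * D * N) * h) ^ 2) / (real N ^ 2 * \<alpha>) ^ 2
        = 13312 * real D ^ 2 * (T / \<alpha> ^ 2)"
      using scaling[of "real N" "real D"] N by (simp add: T_def)
    moreover have "real (2 * N) ^ CARD('k) * real (card E) * real (card F)
        = real N ^ CARD('k) * 2 ^ CARD('k) * (R * R)"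
      using R(2) by (simp add: power_mult_distrib power2_eq_square)
    ultimately show ?thesis by (simp only: times_divide_eq_left times_divide_eq_right mult_ac)
  qed
  also have "T * R / \<alpha> ^ 2 = (T * R) powr u"
  proof -
    have "\<alpha> ^ 2 = (T * R) powr (4 / (k + 4))"
      unfolding \<alpha>_def power2_eq_square powr_add[symmetric] by simp
    then have "T * R / \<alpha> ^ 2 = (T * R) powr (1 - 4 / (k + 4))" using TR by (simp add: powr_diff)
    also have "1 - 4 / (k + 4) = u" using k by (simp add: u_def field_simps)
    finally show ?thesis .
  qed
  finally have "real N ^ CARD('k) * real (incidences A N E F) \<le> real N ^ CARD('k) *
      ((1 + 2 ^ CARD('k) * 13312 * real D ^ 2) * (R * (T * R) powr u))"
    by (simp add: algebra_simps)
  then have "real (incidences A N E F) \<le> (1 + 2 ^ CARD('k) * 13312 * real D ^ 2) * (R * (T * R) powr u)"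
    using N by simp
  also have "R * (T * R) powr u = T powr u * R powr (1 + u)"
    using T R by (simp add: powr_mult powr_add)
  also have "R powr (1 + u) = (real (card E) * real (card F)) powr ((1 + u) / 2)"
    using ef unfolding R_def powr_half_sqrt[OF less_imp_le[OF ef], symmetric] powr_powr by simp
  also have "(1 + u) / 2 = (k + 2) / (k + 4)" using k by (simp add: u_def field_simps)
  finally show ?thesis by (simp add: T_def h_def u_def mult.assoc)
qed

text \<open>
  The harmonic numbers grow logarithmically and are absorbed into \<open>N\<close> to the power \<open>\<epsilon>\<close>.
\<close>

lemma incidences_critical:
  fixes A :: "int ^ 'k ^ 'k::finite"
  assumes "pos_def_form A" "\<epsilon> > 0"
  defines "k \<equiv> real CARD('k)"
  shows "\<exists>C>0. \<forall>N\<ge>1. \<forall>E F. finite E \<longrightarrow> finite F \<longrightarrow> E \<noteq> {} \<longrightarrow> F \<noteq> {} \<longrightarrow>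
     real (incidences A N E F) \<le> C * real N powr ((2 + \<epsilon>) * k / (k + 4)) *
       (real (card E) * real (card F)) powr ((k + 2) / (k + 4))"
proof -
  obtain D where D: "D \<ge> 1" "\<And>N h. h \<in> box N \<Longrightarrow> polar A h \<in> box (int D * N)"
    using polar_bounded[of A] by blast
  define u where "u = k / (k + 4)"
  define C3 where "C3 = (1 + 1 / (\<epsilon> / 2)) ^ 2 * real (4 * D) powr \<epsilon>"
  define C1 where "C1 = 1 + 2 ^ CARD('k) * 13312 * real D ^ 2"
  have C1: "C1 > 0" unfolding C1_def by (intro add_pos_nonneg) simp_all
  have C3: "C3 > 0" using D(1) \<open>\<epsilon> > 0\<close> unfolding C3_def by (intro mult_pos_pos zero_less_power add_pos_pos) simp_all
  have k: "k > 0" by (simp add: k_def)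
  have "real (incidences A N E F) \<le> (C1 * C3 powr u) * real N powr ((2 + \<epsilon>) * k / (k + 4)) *
       (real (card E) * real (card F)) powr ((k + 2) / (k + 4))"
    if that: "N \<ge> 1" "finite E" "finite F" "E \<noteq> {}" "F \<noteq> {}" for N E F
  proof -
    have N: "real N > 0" using that by simp
    have "harm (4 * D * N) \<le> (1 + 1 / (\<epsilon> / 2)) * real (4 * D * N) powr (\<epsilon> / 2)"
      using that D(1) assms(2) by (intro harm_le_powr) auto
    then have "harm (4 * D * N) ^ 2 \<le> ((1 + 1 / (\<epsilon> / 2)) * real (4 * D * N) powr (\<epsilon> / 2)) ^ 2"
      by (intro power_mono harm_nonneg)
    also have "\<dots> = (1 + 1 / (\<epsilon> / 2)) ^ 2 * real (4 * D * N) powr \<epsilon>"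
      unfolding power_mult_distrib by (simp only: power2_eq_square powr_add[symmetric]) simp
    also have "\<dots> = C3 * real N powr \<epsilon>" by (simp add: C3_def powr_mult)
    finally have "real N ^ 2 * harm (4 * D * N) ^ 2 \<le> real N ^ 2 * (C3 * real N powr \<epsilon>)"
      by (rule mult_left_mono) simp
    also have "real N ^ 2 * (C3 * real N powr \<epsilon>) = C3 * real N powr (2 + \<epsilon>)"
      using N by (simp add: powr_add)
    finally have "(real N ^ 2 * harm (4 * D * N) ^ 2) powr u \<le> (C3 * real N powr (2 + \<epsilon>)) powr u"
      using k by (intro powr_mono2) (auto simp: u_def)
    also have "\<dots> = C3 powr u * real N powr ((2 + \<epsilon>) * k / (k + 4))"
      using C3 by (simp add: powr_mult powr_powr u_def)
    finally have b: "(real N ^ 2 * harm (4 * D * N) ^ 2) powr u \<le> C3 powr u * real N powr ((2 + \<epsilon>) * k / (k + 4))" .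
    have "real (incidences A N E F) \<le> C1 * (real N ^ 2 * harm (4 * D * N) ^ 2) powr u *
        (real (card E) * real (card F)) powr ((k + 2) / (k + 4))"
      unfolding C1_def u_def k_def by (rule incidences_critical_harm[OF polar_inj[OF assms(1)] D(2) D(1)]) (use that in auto)
    also have "\<dots> \<le> C1 * (C3 powr u * real N powr ((2 + \<epsilon>) * k / (k + 4))) *
        (real (card E) * real (card F)) powr ((k + 2) / (k + 4))"
      using b C1 by (intro mult_right_mono mult_left_mono) auto
    finally show ?thesis by (simp add: mult.assoc)
  qed
  moreover have "C1 * C3 powr u > 0" using C1 C3 by simp
  ultimately show ?thesis by blast
qed

lemma card_box: "N \<ge> 0 \<Longrightarrow> card (box N :: (int ^ 'k::finite) set) = nat (2 * N + 1) ^ CARD('k)"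
  using bij_betw_same_card[OF bij_betw_vec_box[where 'k = 'k, of N]] by (simp add: card_PiE)

lemma card_box_le:
  assumes "N \<ge> 1"
  shows "real (card (box (int N) :: (int ^ 'k::finite) set)) \<le> 3 ^ CARD('k) * real N ^ CARD('k)"
proof -
  have "nat (2 * int N + 1) ^ CARD('k) \<le> (3 * N) ^ CARD('k)" using assms by (intro power_mono) auto
  then have "real (nat (2 * int N + 1) ^ CARD('k)) \<le> real ((3 * N) ^ CARD('k))" by (rule of_nat_mono)
  then show ?thesis by (simp only: card_box of_nat_0_le_iff) (simp add: power_mult_distrib)
qed

lemma incidences_trivial_bounds:
  fixes A :: "int ^ 'k ^ 'k::finite"
  assumes "N \<ge> 1" "finite E" "finite F"
  shows "real (incidences A N E F) \<le> real (card E) * real (card F)"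
    and "real (incidences A N E F) \<le> 3 ^ CARD('k) * real N ^ CARD('k) * real (card E)"
    and "real (incidences A N E F) \<le> 3 ^ CARD('k) * real N ^ CARD('k) * real (card F)"
proof -
  let ?I = "{(v, w) \<in> F \<times> E. fst v - fst w \<in> box (int N) \<and> snd v - snd w = quad_form A (fst v - fst w)}"
  have "card ?I \<le> card (F \<times> E)" using assms by (intro card_mono) auto
  then show "real (incidences A N E F) \<le> real (card E) * real (card F)"
    by (simp add: incidences_def card_cartesian_product mult.commute flip: of_nat_mult)
  have "card ?I \<le> card (box (int N) \<times> E :: ((int ^ 'k) \<times> _) set)"
  proof (rule card_inj_on_le[of "\<lambda>(v, w). (fst v - fst w, w)"])
    show "inj_on (\<lambda>(v, w). (fst v - fst w, w)) ?I" by (auto simp: inj_on_def)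
  qed (auto simp: finite_box assms)
  then have "real (incidences A N E F) \<le> real (card (box (int N) :: (int ^ 'k) set)) * real (card E)"
    by (simp add: incidences_def card_cartesian_product flip: of_nat_mult)
  also have "\<dots> \<le> 3 ^ CARD('k) * real N ^ CARD('k) * real (card E)"
    by (intro mult_right_mono card_box_le assms) simp
  finally show "real (incidences A N E F) \<le> 3 ^ CARD('k) * real N ^ CARD('k) * real (card E)" .
  have "card ?I \<le> card (box (int N) \<times> F :: ((int ^ 'k) \<times> _) set)"
  proof (rule card_inj_on_le[of "\<lambda>(v, w). (fst v - fst w, v)"])
    show "inj_on (\<lambda>(v, w). (fst v - fst w, v)) ?I" by (auto simp: inj_on_def)
  qed (auto simp: finite_box assms)
  then have "real (incidences A N E F) \<le> real (card (box (int N) :: (int ^ 'k) set)) * real (card F)"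
    by (simp add: incidences_def card_cartesian_product flip: of_nat_mult)
  also have "\<dots> \<le> 3 ^ CARD('k) * real N ^ CARD('k) * real (card F)"
    by (intro mult_right_mono card_box_le assms) simp
  finally show "real (incidences A N E F) \<le> 3 ^ CARD('k) * real N ^ CARD('k) * real (card F)" .
qed

section \<open>Interpolating the incidence bounds\<close>

lemma cancel_common_factor:
  fixes c d e g :: real
  shows "d \<noteq> 0 \<Longrightarrow> (c * d / e) * (g / d) = c * g / e"
  by simp

text \<open>
  In logarithmic form, the four hypotheses are bounds at the points \<open>(1,0)\<close>, \<open>(0,1)\<close>, \<open>(1,1)\<close> and \<open>V = (X,X)\<close>,
  \<open>X = (k+2)/(k+4)\<close>, of the plane of pairs \<open>(x,z)\<close>.  The part \<open>x \<le> z\<close> of the triangle with corners \<open>(1,0)\<close>, \<open>(0,1)\<close>,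
  \<open>(1,1)\<close> is covered by the triangles \<open>(0,1), V, (1,1)\<close> and \<open>(0,1), V, (1,0)\<close>, and barycentric
  coordinates in these give the convex combination.  The two bounds required of \<open>\<mu>\<close> are the exponents of \<open>N\<close> that result.
\<close>

lemma interpolate_exponents_ordered:
  fixes s K n a b k x z \<epsilon> :: real
  assumes b10: "s \<le> K + k * n + a" and b01: "s \<le> K + k * n + b" and b11: "s \<le> K + a + b"
    and bV: "s \<le> K + (2 + \<epsilon>) * k / (k + 4) * n + (k + 2) / (k + 4) * (a + b)"
    and pos: "k > 0" "n \<ge> 0" "\<epsilon> \<ge> 0"
    and xz: "0 \<le> x" "x \<le> z" "z \<le> 1" "1 \<le> x + z"
    and \<mu>: "k * (1 - x) \<le> \<mu>" "k - (k + 2) * (x + z - 1) \<le> \<mu>"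
  shows "s \<le> K + (\<mu> + \<epsilon>) * n + x * a + z * b"
proof (cases "(1 - z) * (k + 2) \<le> 2 * x")
  case True
  define v where "v = (1 - z) * (k + 4) / 2"
  define w where "w = x - (1 - z) * (k + 2) / 2"
  have nn: "v \<ge> 0" "z - x \<ge> 0" "w \<ge> 0" using pos xz True by (auto simp: v_def w_def)
  have one: "v + (z - x) + w = 1" by (simp add: v_def w_def field_simps)
  have "k + 4 \<noteq> 0" using pos by linarith
  then have v1: "v * (k / (k + 4)) = (1 - z) * k / 2" "v * ((k + 2) / (k + 4)) = (1 - z) * (k + 2) / 2"
    unfolding v_def by (simp_all only: cancel_common_factor not_False_eq_True)
  have "s = v * s + (z - x) * s + w * s"
    unfolding distrib_right[symmetric] one by simp
  also have "\<dots> \<le> v * (K + (2 + \<epsilon>) * k / (k + 4) * n + (k + 2) / (k + 4) * (a + b))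
      + (z - x) * (K + k * n + b) + w * (K + a + b)"
    by (intro add_mono mult_left_mono nn bV b01 b11)
  also have "\<dots> = (v + (z - x) + w) * K + (2 + \<epsilon>) * n * (v * (k / (k + 4))) + (z - x) * k * n
      + v * ((k + 2) / (k + 4)) * (a + b) + (z - x) * b + w * (a + b)"
    by (simp add: algebra_simps)
  also have "\<dots> = K + (k * (1 - x) + \<epsilon> * ((1 - z) * k / 2)) * n + x * a + z * b"
    unfolding one v1 by (simp add: w_def field_simps)
  also have "\<dots> \<le> K + (\<mu> + \<epsilon>) * n + x * a + z * b"
  proof -
    have "(1 - z) * k / 2 \<le> v" using xz by (simp add: v_def mult_left_mono)
    then have "\<epsilon> * ((1 - z) * k / 2) \<le> \<epsilon> * 1"
      using one nn pos by (intro mult_left_mono) linarith+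
    then have "(k * (1 - x) + \<epsilon> * ((1 - z) * k / 2)) * n \<le> (\<mu> + \<epsilon>) * n"
      using \<mu> pos by (intro mult_right_mono) linarith+
    then show ?thesis by linarith
  qed
  finally show ?thesis .
next
  case False
  define t where "t = x + z - 1"
  define v where "v = t * (k + 4) / k"
  define w1 where "w1 = z - t * (k + 2) / k"
  define w2 where "w2 = x - t * (k + 2) / k"
  have t0: "t \<ge> 0" using xz by (simp add: t_def)
  have "k * w2 = (k + 2) * (1 - z) - 2 * x"
    using pos by (simp add: w2_def t_def field_simps)
  then have "k * w2 \<ge> 0" using False by (simp add: mult.commute)
  then have w2: "w2 \<ge> 0" using pos by (simp add: zero_le_mult_iff)
  have "w1 = w2 + (z - x)" by (simp add: w1_def w2_def)
  then have w1: "w1 \<ge> 0" using w2 xz by simp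
  have v: "v \<ge> 0" using pos t0 by (simp add: v_def)
  have one: "v + w1 + w2 = 1" using pos by (simp add: v_def w1_def w2_def t_def field_simps)
  have "k + 4 \<noteq> 0" using pos by linarith
  then have v1: "v * (k / (k + 4)) = t * k / k" "v * ((k + 2) / (k + 4)) = t * (k + 2) / k"
    unfolding v_def by (simp_all only: cancel_common_factor not_False_eq_True)
  have tk: "t * k / k = t" using pos by simp
  have w12: "w1 + w2 = 1 - v" using one by linarith
  have vk: "v * k = t * (k + 4)" using pos by (simp add: v_def)
  have "s = v * s + w1 * s + w2 * s"
    unfolding distrib_right[symmetric] one by simp
  also have "\<dots> \<le> v * (K + (2 + \<epsilon>) * k / (k + 4) * n + (k + 2) / (k + 4) * (a + b))
      + w1 * (K + k * n + b) + w2 * (K + k * n + a)"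
    by (intro add_mono mult_left_mono w1 w2 v bV b01 b10)
  also have "\<dots> = (v + w1 + w2) * K + ((2 + \<epsilon>) * (v * (k / (k + 4))) + k * (w1 + w2)) * n
      + (v * ((k + 2) / (k + 4)) + w2) * a + (v * ((k + 2) / (k + 4)) + w1) * b"
    by (simp add: algebra_simps add_divide_distrib)
  also have "\<dots> = K + ((2 + \<epsilon>) * t + k - v * k) * n + x * a + z * b"
    unfolding one v1 tk w12 by (simp add: w1_def w2_def algebra_simps)
  also have "\<dots> = K + (k - (k + 2) * t + \<epsilon> * t) * n + x * a + z * b"
    unfolding vk by (simp add: algebra_simps)
  also have "\<dots> \<le> K + (\<mu> + \<epsilon>) * n + x * a + z * b"
  proof -
    have "\<epsilon> * t \<le> \<epsilon> * 1" using xz pos by (intro mult_left_mono) (simp_all add: t_def)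
    then have "(k - (k + 2) * t + \<epsilon> * t) * n \<le> (\<mu> + \<epsilon>) * n"
      using \<mu> pos unfolding t_def by (intro mult_right_mono) linarith+
    then show ?thesis by linarith
  qed
  finally show ?thesis .
qed

lemma interpolate_exponents:
  fixes s K n a b k x z \<epsilon> :: real
  assumes b10: "s \<le> K + k * n + a" and b01: "s \<le> K + k * n + b" and b11: "s \<le> K + a + b"
    and bV: "s \<le> K + (2 + \<epsilon>) * k / (k + 4) * n + (k + 2) / (k + 4) * (a + b)"
    and pos: "k > 0" "n \<ge> 0" "\<epsilon> \<ge> 0"
    and xz: "0 \<le> x" "x \<le> 1" "0 \<le> z" "z \<le> 1" "1 \<le> x + z"
    and \<mu>: "k * (1 - x) \<le> \<mu>" "k * (1 - z) \<le> \<mu>" "k - (k + 2) * (x + z - 1) \<le> \<mu>"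
  shows "s \<le> K + (\<mu> + \<epsilon>) * n + x * a + z * b"
proof (cases "x \<le> z")
  case True
  then show ?thesis using assms by (intro interpolate_exponents_ordered[of s K k n a b \<epsilon>]) auto
next
  case False
  have "s \<le> K + (\<mu> + \<epsilon>) * n + z * b + x * a"
    using assms False by (intro interpolate_exponents_ordered[of s K k n b a \<epsilon>]) (auto simp: algebra_simps)
  then show ?thesis by simp
qed

lemma incidences_restricted_bound:
  fixes A :: "int ^ 'k ^ 'k::finite"
  defines "k \<equiv> real CARD('k)"
  assumes "pos_def_form A"
    and xz: "0 \<le> x" "x \<le> 1" "0 \<le> z" "z \<le> 1" "1 \<le> x + z"
    and \<mu>: "k * (1 - x) < \<mu>" "k * (1 - z) < \<mu>" "k - (k + 2) * (x + z - 1) < \<mu>"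
  shows "\<exists>C>0. \<forall>N\<ge>1. \<forall>E F. finite E \<longrightarrow> finite F \<longrightarrow>
     real (incidences A N E F) \<le> C * real N powr \<mu> * real (card E) powr x * real (card F) powr z"
proof -
  define \<mu>' where "\<mu>' = Max {k * (1 - x), k * (1 - z), k - (k + 2) * (x + z - 1)}"
  have \<mu>': "k * (1 - x) \<le> \<mu>'" "k * (1 - z) \<le> \<mu>'" "k - (k + 2) * (x + z - 1) \<le> \<mu>'"
    unfolding \<mu>'_def by (intro Max_ge; simp)+
  have "\<mu>' < \<mu>" unfolding \<mu>'_def using \<mu> by (subst Max_less_iff) auto
  define \<epsilon> where "\<epsilon> = \<mu> - \<mu>'"
  have \<epsilon>: "\<epsilon> > 0" using \<open>\<mu>' < \<mu>\<close> by (simp add: \<epsilon>_def)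
  note crit = incidences_critical[OF assms(2) \<epsilon>, folded k_def]
  obtain C where C: "C > 0" and C2: "\<forall>N\<ge>1. \<forall>E F. finite E \<longrightarrow> finite F \<longrightarrow> E \<noteq> {} \<longrightarrow> F \<noteq> {} \<longrightarrow>
     real (incidences A N E F) \<le> C * real N powr ((2 + \<epsilon>) * k / (k + 4)) *
       (real (card E) * real (card F)) powr ((k + 2) / (k + 4))"
    using crit by (elim exE conjE) (rule that)
  define K where "K = max (ln C) (real CARD('k) * ln 3)"
  have K: "ln C \<le> K" "real CARD('k) * ln 3 \<le> K" by (simp_all add: K_def)
  have K0: "K \<ge> 0" using K(2) by (rule order_trans[rotated]) simp
  have k: "k > 0" by (simp add: k_def)
  have "real (incidences A N E F) \<le> exp K * real N powr \<mu> * real (card E) powr x * real (card F) powr z"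
    if that: "N \<ge> 1" "finite E" "finite F" for N E F
  proof (cases "incidences A N E F = 0")
    case True then show ?thesis by simp
  next
    case False
    then have ne: "E \<noteq> {}" "F \<noteq> {}" by auto
    have pos: "real (incidences A N E F) > 0" "real N > 0" "real (card E) > 0" "real (card F) > 0"
      using False that ne by (auto simp: card_gt_0_iff)
    define s n a b where "s = ln (real (incidences A N E F))" and "n = ln (real N)"
      and "a = ln (real (card E))" and "b = ln (real (card F))"
    have n: "n \<ge> 0" unfolding n_def using that by simp
    have "s \<le> ln (real (card E) * real (card F))"
      unfolding s_def using pos incidences_trivial_bounds(1)[OF that] by (subst ln_le_cancel_iff) auto
    then have b11: "s \<le> K + a + b" using pos K0 by (simp add: a_def b_def ln_mult)
    have "s \<le> ln (3 ^ CARD('k) * real N ^ CARD('k) * real (card E))"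
      unfolding s_def using pos incidences_trivial_bounds(2)[OF that] by (subst ln_le_cancel_iff) auto
    then have b10: "s \<le> K + k * n + a"
      using pos K(2) by (simp add: a_def n_def k_def ln_mult ln_realpow)
    have "s \<le> ln (3 ^ CARD('k) * real N ^ CARD('k) * real (card F))"
      unfolding s_def using pos incidences_trivial_bounds(3)[OF that] by (subst ln_le_cancel_iff) auto
    then have b01: "s \<le> K + k * n + b"
      using pos K(2) by (simp add: b_def n_def k_def ln_mult ln_realpow)
    have "s \<le> ln (C * real N powr ((2 + \<epsilon>) * k / (k + 4)) *
       (real (card E) * real (card F)) powr ((k + 2) / (k + 4)))"
      unfolding s_def using pos C C2[rule_format, OF that ne] by (subst ln_le_cancel_iff) auto
    also have "\<dots> = ln C + (2 + \<epsilon>) * k / (k + 4) * n + (k + 2) / (k + 4) * (a + b)"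
      using pos C by (simp add: ln_mult ln_powr n_def a_def b_def)
    finally have bV: "s \<le> K + (2 + \<epsilon>) * k / (k + 4) * n + (k + 2) / (k + 4) * (a + b)"
      using K(1) by linarith
    have "s \<le> K + (\<mu>' + \<epsilon>) * n + x * a + z * b"
      by (rule interpolate_exponents[OF b10 b01 b11 bV k n less_imp_le[OF \<epsilon>] xz \<mu>'])
    then have "s \<le> K + \<mu> * n + x * a + z * b" by (simp add: \<epsilon>_def)
    then have "exp s \<le> exp (K + \<mu> * n + x * a + z * b)" by simp
    also have "\<dots> = exp K * real N powr \<mu> * real (card E) powr x * real (card F) powr z"
      using pos by (simp add: exp_add powr_def n_def a_def b_def)
    finally show ?thesis using pos by (simp add: s_def)
  qed
  then show ?thesis by (intro exI[of _ "exp K"]) auto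
qed

section \<open>From restricted bounds to bounds between Lebesgue spaces\<close>

lemma geometric_sum_bound:
  fixes r :: real
  assumes "0 \<le> r" "r < 1"
  shows "(\<Sum>i<l. r ^ i) \<le> 1 / (1 - r)"
  using assms by (simp add: geometric_sum sum_gp_strict divide_right_mono)

lemma dyadic_level:
  fixes u :: real
  assumes "0 < u" "u \<le> 1"
  shows "\<exists>i::nat. 2 powr (- (real i + 1)) \<le> u \<and> u \<le> 2 powr (- real i)"
proof -
  define i where "i = nat \<lfloor>- log 2 u\<rfloor>"
  have "log 2 u \<le> 0" using assms by simp
  then have i: "real i \<le> - log 2 u" "- log 2 u < real i + 1" by (simp_all add: i_def)
  have u: "u = 2 powr (log 2 u)" using assms by simp
  have "2 powr (- (real i + 1)) \<le> 2 powr (log 2 u)" using i by (intro powr_mono) auto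
  moreover have "2 powr (log 2 u) \<le> 2 powr (- real i)" using i by (intro powr_mono) auto
  ultimately show ?thesis using u by auto
qed

lemma le_powr_if_mult_powr_minus_le:
  fixes c :: real
  assumes "c * 2 powr (- y) \<le> b"
  shows "c \<le> b * 2 powr y"
  using assms by (simp add: powr_minus field_simps)

text \<open>
  Each positive value lies between \<open>2 powr (-(i + 1))\<close> and \<open>2 powr (-i)\<close> for some \<open>i \<ge> 0\<close>; superlevel sets, which are easier
  to count than level sets, suffice for the upper bound.
\<close>

lemma dyadic_level_sum:
  fixes u c :: "'a \<Rightarrow> real"
  assumes "finite F" "\<And>v. v \<in> F \<Longrightarrow> 0 \<le> u v \<and> u v \<le> 1" "\<And>v. v \<in> F \<Longrightarrow> c v \<ge> 0" "s > 0"
  shows "\<exists>l. (\<Sum>v\<in>F. u v powr s * c v)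
     \<le> (\<Sum>i<l. 2 powr (- s * real i) * (\<Sum>v\<in>{v\<in>F. u v \<ge> 2 powr (- (real i + 1))}. c v))"
proof -
  have "\<forall>v. \<exists>i::nat. v \<in> F \<and> u v > 0 \<longrightarrow> 2 powr (- (real i + 1)) \<le> u v \<and> u v \<le> 2 powr (- real i)"
    using dyadic_level assms(2) by blast
  then obtain j :: "'a \<Rightarrow> nat" where j: "\<And>v. v \<in> F \<Longrightarrow> u v > 0 \<Longrightarrow>
      2 powr (- (real (j v) + 1)) \<le> u v \<and> u v \<le> 2 powr (- real (j v))"
    by metis
  define l where "l = Suc (\<Sum>v\<in>F. j v)"
  have jl: "j v < l" if "v \<in> F" for v
    unfolding l_def less_Suc_eq_le using that assms(1) by (intro member_le_sum) auto
  let ?t = "\<lambda>i v. 2 powr (- s * real i) * (if u v \<ge> 2 powr (- (real i + 1)) then c v else 0)"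
  have "u v powr s * c v \<le> (\<Sum>i<l. ?t i v)" if v: "v \<in> F" for v
  proof (cases "u v > 0")
    case True
    have "u v powr s \<le> (2 powr (- real (j v))) powr s"
      using j[OF v True] True assms(4) by (intro powr_mono2) auto
    also have "\<dots> = 2 powr (- s * real (j v))" by (simp add: powr_powr mult.commute)
    finally have "u v powr s * c v \<le> ?t (j v) v"
      using j[OF v True] assms(3)[OF v] by (auto intro: mult_right_mono)
    also have "\<dots> \<le> (\<Sum>i<l. ?t i v)"
      by (rule member_le_sum[of "j v" "{..<l}" "\<lambda>i. ?t i v"]) (use jl[OF v] assms(3)[OF v] in auto)
    finally show ?thesis .
  next
    case False
    then have "u v = 0" using assms(2)[OF v] by simp
    then show ?thesis using assms(3)[OF v] by (simp add: sum_nonneg)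
  qed
  then have "(\<Sum>v\<in>F. u v powr s * c v) \<le> (\<Sum>v\<in>F. \<Sum>i<l. ?t i v)" by (rule sum_mono)
  also have "\<dots> = (\<Sum>i<l. \<Sum>v\<in>F. ?t i v)" by (rule sum.swap)
  also have "\<dots> = (\<Sum>i<l. 2 powr (- s * real i) * (\<Sum>v\<in>{v\<in>F. u v \<ge> 2 powr (- (real i + 1))}. c v))"
    using assms(1) by (simp add: sum_distrib_left[symmetric] sum.inter_filter)
  finally show ?thesis by blast
qed

text \<open>
  A function of norm at most \<open>1\<close> in \<open>\<ell>\<^sup>p\<close> is bounded by \<open>1\<close>, and its superlevel set at height \<open>2 powr (-(i + 1))\<close> has at
  most \<open>2 powr (p (i + 1))\<close> elements.  So the level \<open>i\<close> contributes \<open>O(2 powr (i (p x - 1)))\<close>, a geometric series.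
\<close>

lemma restricted_to_strong_source:
  fixes K :: "'b \<Rightarrow> 'a \<Rightarrow> real"
  assumes K0: "\<And>v w. K v w \<ge> 0"
    and KC: "\<And>E F. finite E \<Longrightarrow> finite F \<Longrightarrow>
      (\<Sum>v\<in>F. \<Sum>w\<in>E. K v w) \<le> C * real (card E) powr x * real (card F) powr z"
    and "C > 0" "p \<ge> 1" "0 \<le> x" "p * x < 1"
  shows "\<exists>C'>0. \<forall>E F a. finite E \<longrightarrow> finite F \<longrightarrow> (\<forall>w\<in>E. a w \<ge> 0) \<longrightarrow> (\<Sum>w\<in>E. a w powr p) \<le> 1 \<longrightarrow>
      (\<Sum>v\<in>F. \<Sum>w\<in>E. K v w * a w) \<le> C' * real (card F) powr z"
proof -
  define r where "r = 2 powr (p * x - 1)"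
  have r: "0 \<le> r" "r < 1" using assms(6) unfolding r_def by (simp_all add: powr_less_one)
  define C' where "C' = C * 2 powr (p * x) * (1 / (1 - r))"
  have "(\<Sum>v\<in>F. \<Sum>w\<in>E. K v w * a w) \<le> C' * real (card F) powr z"
    if E: "finite E" and F: "finite F" and a0: "\<forall>w\<in>E. a w \<ge> 0" and a1: "(\<Sum>w\<in>E. a w powr p) \<le> 1" for E F a
  proof -
    have ap: "a w powr p \<le> 1" if "w \<in> E" for w
    proof -
      have "a w powr p \<le> (\<Sum>w\<in>E. a w powr p)" using that E by (intro member_le_sum) auto
      then show ?thesis using a1 by linarith
    qed
    have aw: "a w \<le> 1" if "w \<in> E" for w
    proof (rule ccontr)
      assume "\<not> a w \<le> 1"
      then have "a w powr p > 1" using assms(4) by (intro gr_one_powr) auto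
      then show False using ap[OF that] by simp
    qed
    let ?E = "\<lambda>i. {w\<in>E. a w \<ge> 2 powr (- (real i + 1))}"
    have level: "(\<Sum>w\<in>?E i. \<Sum>v\<in>F. K v w) \<le> C * 2 powr (p * x) * 2 powr (p * x * real i) * real (card F) powr z" for i :: nat
    proof -
      have "real (card (?E i)) * 2 powr (- ((real i + 1) * p)) = (\<Sum>w\<in>?E i. (2 powr (- (real i + 1))) powr p)"
        by (simp add: powr_powr minus_mult_left)
      also have "\<dots> \<le> (\<Sum>w\<in>?E i. a w powr p)"
        using assms(4) by (intro sum_mono powr_mono2) auto
      also have "\<dots> \<le> (\<Sum>w\<in>E. a w powr p)" using E by (intro sum_mono2) auto
      finally have "real (card (?E i)) * 2 powr (- ((real i + 1) * p)) \<le> 1" using a1 by linarith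
      then have "real (card (?E i)) \<le> 2 powr ((real i + 1) * p)"
        using le_powr_if_mult_powr_minus_le by fastforce
      then have "real (card (?E i)) powr x \<le> (2 powr ((real i + 1) * p)) powr x"
        using assms(5) by (intro powr_mono2) auto
      also have "\<dots> = 2 powr (p * x) * 2 powr (p * x * real i)"
        by (simp add: powr_powr powr_add[symmetric] algebra_simps)
      finally have c: "real (card (?E i)) powr x \<le> 2 powr (p * x) * 2 powr (p * x * real i)" .
      have "(\<Sum>w\<in>?E i. \<Sum>v\<in>F. K v w) = (\<Sum>v\<in>F. \<Sum>w\<in>?E i. K v w)" by (rule sum.swap)
      also have "\<dots> \<le> C * real (card (?E i)) powr x * real (card F) powr z"
        using E F by (intro KC) auto
      also have "\<dots> \<le> C * (2 powr (p * x) * 2 powr (p * x * real i)) * real (card F) powr z"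
        using c assms(3) by (intro mult_right_mono mult_left_mono) auto
      finally show ?thesis by (simp add: mult.assoc)
    qed
    have "\<exists>l. (\<Sum>w\<in>E. a w powr 1 * (\<Sum>v\<in>F. K v w))
        \<le> (\<Sum>i<l. 2 powr (- 1 * real i) * (\<Sum>w\<in>?E i. \<Sum>v\<in>F. K v w))"
      using a0 aw K0 by (intro dyadic_level_sum E) (auto simp: sum_nonneg)
    then obtain l where l: "(\<Sum>w\<in>E. a w powr 1 * (\<Sum>v\<in>F. K v w))
        \<le> (\<Sum>i<l. 2 powr (- 1 * real i) * (\<Sum>w\<in>?E i. \<Sum>v\<in>F. K v w))" by blast
    have "(\<Sum>v\<in>F. \<Sum>w\<in>E. K v w * a w) = (\<Sum>w\<in>E. a w powr 1 * (\<Sum>v\<in>F. K v w))"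
      using a0 by (subst sum.swap) (simp add: sum_distrib_left mult.commute)
    also note l
    also have "(\<Sum>i<l. 2 powr (- 1 * real i) * (\<Sum>w\<in>?E i. \<Sum>v\<in>F. K v w))
       \<le> (\<Sum>i<l. 2 powr (- 1 * real i) * (C * 2 powr (p * x) * 2 powr (p * x * real i) * real (card F) powr z))"
      by (intro sum_mono mult_left_mono level) simp
    also have "\<dots> = (\<Sum>i<l. C * 2 powr (p * x) * real (card F) powr z * r ^ i)"
    proof (intro sum.cong refl)
      fix i
      have "r ^ i = r powr real i" using r_def by (simp add: powr_realpow)
      also have "\<dots> = 2 powr (- 1 * real i) * 2 powr (p * x * real i)"
        by (simp add: r_def powr_powr powr_add[symmetric] algebra_simps)
      finally show "2 powr (- 1 * real i) * (C * 2 powr (p * x) * 2 powr (p * x * real i) * real (card F) powr z)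
          = C * 2 powr (p * x) * real (card F) powr z * r ^ i" by simp
    qed
    also have "\<dots> = C * 2 powr (p * x) * real (card F) powr z * (\<Sum>i<l. r ^ i)"
      by (simp only: sum_distrib_left)
    also have "\<dots> \<le> C * 2 powr (p * x) * real (card F) powr z * (1 / (1 - r))"
      using assms(3) by (intro mult_left_mono geometric_sum_bound r) auto
    finally show ?thesis by (simp add: C'_def mult_ac)
  qed
  moreover have "C' > 0" using assms(3) r by (simp add: C'_def)
  ultimately show ?thesis by blast
qed

text \<open>
  Testing on singletons shows \<open>h \<le> B\<close>; testing on a superlevel set bounds its size, and the strict inequality
  \<open>1 / (1 - z) < q\<close> makes the sum over levels a convergent geometric series.
\<close>

lemma weak_to_strong_target:
  assumes "0 \<le> z" "z < 1" "q * (1 - z) > 1" "q \<ge> 1"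
  shows "\<exists>C'>0. \<forall>(h :: 'b \<Rightarrow> real) B. B > 0 \<longrightarrow> (\<forall>v. h v \<ge> 0) \<longrightarrow>
     (\<forall>F. finite F \<longrightarrow> (\<Sum>v\<in>F. h v) \<le> B * real (card F) powr z) \<longrightarrow>
     (\<forall>F. finite F \<longrightarrow> (\<Sum>v\<in>F. h v powr q) \<le> C' * B powr q)"
proof -
  define r where "r = 2 powr (1 / (1 - z) - q)"
  have "1 / (1 - z) < q" using assms by (simp add: field_simps)
  then have r: "0 \<le> r" "r < 1" unfolding r_def by (simp_all add: powr_less_one)
  define C' where "C' = 2 powr (1 / (1 - z)) * (1 / (1 - r))"
  have "(\<Sum>v\<in>F. h v powr q) \<le> C' * B powr q"
    if B: "B > 0" and h: "\<forall>v. h v \<ge> 0"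
      and w: "\<forall>F. finite F \<longrightarrow> (\<Sum>v\<in>F. h v) \<le> B * real (card F) powr z" and F: "finite F"
    for h :: "'b \<Rightarrow> real" and B F
  proof -
    define u where "u v = h v / B" for v
    have u1: "u v \<le> 1" for v using w[rule_format, of "{v}"] B by (simp add: u_def)
    have u0: "u v \<ge> 0" for v using h B by (simp add: u_def)
    let ?F = "\<lambda>i. {v\<in>F. u v \<ge> 2 powr (- (real i + 1))}"
    have level: "real (card (?F i)) \<le> 2 powr (1 / (1 - z)) * 2 powr (real i / (1 - z))" for i :: nat
    proof (cases "card (?F i) = 0")
      case True then show ?thesis by (simp only: of_nat_0) simp
    next
      case False
      define c where "c = real (card (?F i))"
      have c: "c > 0" using False by (simp only: c_def)
      have "c * 2 powr (- (real i + 1)) = (\<Sum>v\<in>?F i. 2 powr (- (real i + 1)))" by (simp add: c_def)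
      also have "\<dots> \<le> (\<Sum>v\<in>?F i. u v)" by (intro sum_mono) auto
      also have "\<dots> = (\<Sum>v\<in>?F i. h v) / B" by (simp add: u_def sum_divide_distrib)
      also have "\<dots> \<le> (B * c powr z) / B"
        unfolding c_def using w F B by (intro divide_right_mono) auto
      also have "\<dots> = c powr z" using B by simp
      finally have "c * 2 powr (- (real i + 1)) \<le> c powr z" .
      then have "c \<le> c powr z * 2 powr (real i + 1)" by (rule le_powr_if_mult_powr_minus_le)
      then have "c / c powr z \<le> 2 powr (real i + 1)" using c by (simp add: divide_le_eq mult.commute)
      also have "c / c powr z = c powr (1 - z)" using c by (simp add: powr_diff)
      finally have "(c powr (1 - z)) powr (1 / (1 - z)) \<le> (2 powr (real i + 1)) powr (1 / (1 - z))"
        using assms by (intro powr_mono2) auto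
      then have "c \<le> 2 powr ((real i + 1) * (1 / (1 - z)))"
        using assms c by (simp add: powr_powr)
      also have "(real i + 1) * (1 / (1 - z)) = 1 / (1 - z) + real i / (1 - z)"
        by (simp add: add_divide_distrib)
      finally show ?thesis by (simp add: c_def powr_add)
    qed
    have "\<exists>l. (\<Sum>v\<in>F. u v powr q * 1) \<le> (\<Sum>i<l. 2 powr (- q * real i) * (\<Sum>v\<in>?F i. 1))"
      using u0 u1 assms by (intro dyadic_level_sum F) auto
    then obtain l where l: "(\<Sum>v\<in>F. u v powr q * 1) \<le> (\<Sum>i<l. 2 powr (- q * real i) * (\<Sum>v\<in>?F i. 1))" by blast
    have "(\<Sum>v\<in>F. u v powr q) \<le> (\<Sum>i<l. 2 powr (- q * real i) * real (card (?F i)))" using l by simp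
    also have "\<dots> \<le> (\<Sum>i<l. 2 powr (- q * real i) * (2 powr (1 / (1 - z)) * 2 powr (real i / (1 - z))))"
      by (intro sum_mono mult_left_mono level) simp
    also have "\<dots> = (\<Sum>i<l. 2 powr (1 / (1 - z)) * r ^ i)"
    proof (intro sum.cong refl)
      fix i
      have "r ^ i = r powr real i" using r_def by (simp add: powr_realpow)
      also have "\<dots> = 2 powr (- q * real i) * 2 powr (real i / (1 - z))"
        by (simp add: r_def powr_powr powr_add[symmetric] left_diff_distrib)
      finally show "2 powr (- q * real i) * (2 powr (1 / (1 - z)) * 2 powr (real i / (1 - z)))
          = 2 powr (1 / (1 - z)) * r ^ i" by simp
    qed
    also have "\<dots> = 2 powr (1 / (1 - z)) * (\<Sum>i<l. r ^ i)" by (simp only: sum_distrib_left)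
    also have "\<dots> \<le> C'" unfolding C'_def by (intro mult_left_mono geometric_sum_bound r) simp
    finally have uq: "(\<Sum>v\<in>F. u v powr q) \<le> C'" .
    have "(\<Sum>v\<in>F. h v powr q) = (\<Sum>v\<in>F. u v powr q) * B powr q"
      unfolding sum_distrib_right
    proof (intro sum.cong refl)
      fix v
      have "h v = u v * B" using B by (simp add: u_def)
      then show "h v powr q = u v powr q * B powr q" using u0 B by (simp add: powr_mult)
    qed
    then show ?thesis using uq by (simp add: mult_right_mono)
  qed
  moreover have "C' > 0" using r by (simp add: C'_def)
  ultimately show ?thesis by blast
qed

lemma lp_norm_finite_support:
  assumes "finite {x. f x \<noteq> 0}" "p \<noteq> \<infinity>"
  shows "lp_norm p f = (\<Sum>x\<in>{x. f x \<noteq> 0}. norm (f x) powr real_of_ereal p) powr (1 / real_of_ereal p)"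
proof -
  have "(\<Sum>\<^sub>\<infinity>x. norm (f x) powr real_of_ereal p) = (\<Sum>\<^sub>\<infinity>x\<in>{x. f x \<noteq> 0}. norm (f x) powr real_of_ereal p)"
    by (rule infsum_cong_neutral) auto
  then show ?thesis using assms by (simp add: lp_norm_def)
qed

lemma in_lp_bounded_sums:
  fixes f :: "'a \<Rightarrow> complex"
  assumes "1 \<le> q" "q \<noteq> \<infinity>"
    and le: "\<And>F. finite F \<Longrightarrow> (\<Sum>x\<in>F. norm (f x) powr real_of_ereal q) \<le> S powr real_of_ereal q" and "S \<ge> 0"
  shows "in_lp q f" "lp_norm q f \<le> S"
proof -
  define r where "r = real_of_ereal q"
  have r: "r \<ge> 1" using assms(1,2) by (cases q) (auto simp: r_def one_ereal_def)
  let ?g = "\<lambda>x. norm (f x) powr r"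
  have summ: "?g summable_on UNIV"
  proof (rule nonneg_bdd_above_summable_on)
    show "bdd_above (sum ?g ` {F. F \<subseteq> UNIV \<and> finite F})"
      using le unfolding r_def by (intro bdd_aboveI[of _ "S powr real_of_ereal q"]) auto
  qed simp
  then show "in_lp q f" using assms by (simp add: in_lp_def r_def)
  have "infsum ?g UNIV \<le> S powr r"
    by (rule infsum_le_finite_sums[OF summ]) (use le in \<open>auto simp: r_def\<close>)
  then have "(infsum ?g UNIV) powr (1 / r) \<le> (S powr r) powr (1 / r)"
    using r by (intro powr_mono2) (auto intro: infsum_nonneg)
  also have "\<dots> = S" using r assms(4) by (simp add: powr_powr)
  finally show "lp_norm q f \<le> S" using assms by (simp add: lp_norm_def r_def)
qed

text \<open>
  Decomposing \<open>f\<close> into dyadic levels, at the cost of lowering \<open>p\<close> below \<open>1/x\<close>, leaves a weak-type bound for \<open>T f\<close> tested on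
  finite sets; decomposing \<open>T f\<close>, at the cost of raising \<open>q\<close> above \<open>1/(1-z)\<close>, turns this into a norm bound.
\<close>

lemma extends_to_bounded_if_restricted_bound:
  fixes K :: "'b \<Rightarrow> 'a \<Rightarrow> real" and T :: "('a \<Rightarrow> complex) \<Rightarrow> 'b \<Rightarrow> complex"
  assumes K0: "\<And>v w. K v w \<ge> 0"
    and KC: "\<And>E F. finite E \<Longrightarrow> finite F \<Longrightarrow>
      (\<Sum>v\<in>F. \<Sum>w\<in>E. K v w) \<le> C * real (card E) powr x * real (card F) powr z"
    and T: "\<And>f v. finite {w. f w \<noteq> 0} \<Longrightarrow> norm (T f v) \<le> (\<Sum>w\<in>{w. f w \<noteq> 0}. K v w * norm (f w))"
    and "C > 0" "1 \<le> p" "1 \<le> q"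
    and x: "0 \<le> x" "x < real_of_ereal (1 / p)" and z: "0 \<le> z" "z < 1" "real_of_ereal (1 / q) < 1 - z"
  shows "extends_to_bounded p q T"
proof -
  define pr where "pr = real_of_ereal p"
  have "p \<noteq> \<infinity>" using x by auto
  then have p: "pr \<ge> 1" "p = ereal pr" using assms(5) by (cases p; simp add: pr_def one_ereal_def)+
  have "x < 1 / pr" using x(2) p by (simp add: one_ereal_def)
  then have px: "pr * x < 1" using p by (simp add: field_simps)
  have src_ex: "\<exists>C1>0. \<forall>E F a. finite E \<longrightarrow> finite F \<longrightarrow> (\<forall>w\<in>E. a w \<ge> 0) \<longrightarrow>
      (\<Sum>w\<in>E. a w powr pr) \<le> 1 \<longrightarrow> (\<Sum>v\<in>F. \<Sum>w\<in>E. K v w * a w) \<le> C1 * real (card F) powr z"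
    by (rule restricted_to_strong_source[OF K0 _ assms(4) p(1) x(1) px]) (fact KC)
  obtain C1 where C1: "C1 > 0" and src: "\<forall>E F a. finite E \<longrightarrow> finite F \<longrightarrow> (\<forall>w\<in>E. a w \<ge> 0) \<longrightarrow>
      (\<Sum>w\<in>E. a w powr pr) \<le> 1 \<longrightarrow> (\<Sum>v\<in>F. \<Sum>w\<in>E. K v w * a w) \<le> C1 * real (card F) powr z"
    using src_ex by (elim exE conjE) (rule that)
  define h where "h f v = (\<Sum>w\<in>{w. f w \<noteq> 0}. K v w * norm (f w))" for f :: "'a \<Rightarrow> complex" and v
  have h0: "h f v \<ge> 0" for f v unfolding h_def by (intro sum_nonneg mult_nonneg_nonneg K0) simp
  have weak: "(\<Sum>v\<in>F. h f v) \<le> C1 * lp_norm p f * real (card F) powr z" and pos: "lp_norm p f > 0"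
    if f: "finite {w. f w \<noteq> 0}" "{w. f w \<noteq> 0} \<noteq> {}" and F: "finite F" for f F
  proof -
    let ?E = "{w. f w \<noteq> 0}"
    define N where "N = lp_norm p f"
    have N: "N = (\<Sum>w\<in>?E. norm (f w) powr pr) powr (1 / pr)"
      unfolding N_def pr_def using f \<open>p \<noteq> \<infinity>\<close> by (intro lp_norm_finite_support)
    have s0: "(\<Sum>w\<in>?E. norm (f w) powr pr) > 0" using f by (intro sum_pos) auto
    have N0: "N > 0" unfolding N using s0 by simp
    then show "lp_norm p f > 0" by (simp add: N_def)
    have Npr: "N powr pr = (\<Sum>w\<in>?E. norm (f w) powr pr)" unfolding N using s0 p by (simp add: powr_powr)
    have "(\<Sum>w\<in>?E. (norm (f w) / N) powr pr) = (\<Sum>w\<in>?E. norm (f w) powr pr) / N powr pr"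
      using N0 by (simp add: powr_divide sum_divide_distrib)
    then have "(\<Sum>w\<in>?E. (norm (f w) / N) powr pr) \<le> 1" using s0 by (simp add: Npr)
    then have "(\<Sum>v\<in>F. \<Sum>w\<in>?E. K v w * (norm (f w) / N)) \<le> C1 * real (card F) powr z"
      using f F N0 by (intro src[rule_format]) auto
    also have "(\<Sum>v\<in>F. \<Sum>w\<in>?E. K v w * (norm (f w) / N)) = (\<Sum>v\<in>F. h f v) / N"
      by (simp add: h_def sum_divide_distrib)
    finally show "(\<Sum>v\<in>F. h f v) \<le> C1 * lp_norm p f * real (card F) powr z"
      using N0 by (simp add: N_def[symmetric] field_simps)
  qed
  have zero: "T f v = 0" if "{w. f w \<noteq> 0} = {}" for f v
    using T[of f v] that by simp
  have lp0: "lp_norm p f \<ge> 0" if "finite {w. f w \<noteq> 0}" for f :: "'a \<Rightarrow> complex"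
    using that \<open>p \<noteq> \<infinity>\<close> by (simp add: lp_norm_finite_support)
  show ?thesis
  proof (cases "q = \<infinity>")
    case True
    have "in_lp q (T f) \<and> lp_norm q (T f) \<le> C1 * lp_norm p f" if f: "finite {w. f w \<noteq> 0}" for f
    proof -
      have le: "norm (T f v) \<le> C1 * lp_norm p f" for v
      proof (cases "{w. f w \<noteq> 0} = {}")
        case True
        then show ?thesis
          unfolding zero[OF True] norm_zero by (intro mult_nonneg_nonneg less_imp_le[OF C1] lp0[OF f])
      next
        case False
        have "norm (T f v) \<le> h f v" unfolding h_def by (rule T[OF f])
        also have "\<dots> \<le> C1 * lp_norm p f" using weak[OF f False, of "{v}"] by simp
        finally show ?thesis .
      qed
      then have "bounded (range (T f))" by (auto simp: bounded_iff)
      moreover have "(SUP v. norm (T f v)) \<le> C1 * lp_norm p f" by (rule cSUP_least) (auto intro: le)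
      ultimately show ?thesis using True by (simp add: in_lp_def lp_norm_def)
    qed
    then show ?thesis unfolding extends_to_bounded_def by blast
  next
    case False
    define qr where "qr = real_of_ereal q"
    have q: "qr \<ge> 1" "q = ereal qr" using assms(6) False by (cases q; simp add: qr_def one_ereal_def)+
    have "1 / qr < 1 - z" using z(3) q by (simp add: one_ereal_def)
    then have qz: "qr * (1 - z) > 1" using q by (simp add: field_simps)
    obtain C2 where C2: "C2 > 0" and tgt: "\<forall>(h :: 'b \<Rightarrow> real) B. B > 0 \<longrightarrow> (\<forall>v. h v \<ge> 0) \<longrightarrow>
        (\<forall>F. finite F \<longrightarrow> (\<Sum>v\<in>F. h v) \<le> B * real (card F) powr z) \<longrightarrow>
        (\<forall>F. finite F \<longrightarrow> (\<Sum>v\<in>F. h v powr qr) \<le> C2 * B powr qr)"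
      using weak_to_strong_target[OF z(1,2) qz q(1)] by (elim exE conjE) (rule that)
    define C3 where "C3 = C2 powr (1 / qr) * C1"
    have C3: "C3 > 0" using C1 C2 by (simp add: C3_def)
    have "in_lp q (T f) \<and> lp_norm q (T f) \<le> C3 * lp_norm p f" if f: "finite {w. f w \<noteq> 0}" for f
    proof -
      have le: "(\<Sum>v\<in>F. norm (T f v) powr qr) \<le> (C3 * lp_norm p f) powr qr" if F: "finite F" for F
      proof (cases "{w. f w \<noteq> 0} = {}")
        case True
        then show ?thesis using zero by simp
      next
        case ne: False
        have N: "lp_norm p f > 0" by (rule pos[OF f ne finite.emptyI])
        have "(\<Sum>v\<in>F. norm (T f v) powr qr) \<le> (\<Sum>v\<in>F. h f v powr qr)"
          unfolding h_def using q T[OF f] by (intro sum_mono powr_mono2) auto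
        also have "\<dots> \<le> C2 * (C1 * lp_norm p f) powr qr"
          using tgt[rule_format, of "C1 * lp_norm p f" "h f" F] C1 N h0 weak[OF f ne] F by simp
        also have "\<dots> = (C3 * lp_norm p f) powr qr"
          using C1 C2 N q by (simp add: C3_def powr_mult powr_powr)
        finally show ?thesis .
      qed
      have nn: "C3 * lp_norm p f \<ge> 0" using C3 lp0[OF f] by simp
      show ?thesis
        using in_lp_bounded_sums[OF assms(6) False le[unfolded qr_def] nn] by blast
    qed
    then show ?thesis unfolding extends_to_bounded_def by blast
  qed
qed

section \<open>The discrete fractional Radon transform\<close>

definition J_kernel :: "int ^ 'k ^ 'k \<Rightarrow> int ^ 'k ^ 'k \<Rightarrow> real \<Rightarrow> (int ^ 'k) \<times> int \<Rightarrow> (int ^ 'k::finite) \<times> int \<Rightarrow> real" where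
  "J_kernel Q1 Q2 lam v w = (if fst v \<noteq> fst w \<and> snd v - snd w = quad_form Q1 (fst v - fst w)
     then 1 / real_of_int (quad_form Q2 (fst v - fst w)) powr (real CARD('k) * lam / 2) else 0)"

lemma J_kernel_nonneg: "J_kernel Q1 Q2 lam v w \<ge> 0"
  by (simp add: J_kernel_def)

lemma norm_J_le:
  fixes Q1 Q2 :: "int ^ 'k ^ 'k::finite"
  assumes "finite {w. f w \<noteq> 0}"
  shows "norm (J Q1 Q2 lam f v) \<le> (\<Sum>w\<in>{w. f w \<noteq> 0}. J_kernel Q1 Q2 lam v w * norm (f w))"
proof -
  obtain n t where v: "v = (n, t)" by (cases v)
  let ?S = "{w. f w \<noteq> 0}"
  define \<phi> where "\<phi> m = (n - m, t - quad_form Q1 m)" for m :: "int ^ 'k"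
  have inj: "inj \<phi>" by (auto simp: inj_def \<phi>_def)
  define M where "M = {m. m \<noteq> 0 \<and> f (\<phi> m) \<noteq> 0}"
  have sub: "\<phi> ` M \<subseteq> ?S" by (auto simp: M_def)
  have finM: "finite M"
    using finite_subset[OF sub assms] inj by (simp add: finite_image_iff inj_on_subset)
  let ?d = "\<lambda>m :: int ^ 'k. complex_of_real (real_of_int (quad_form Q2 m) powr (real CARD('k) * lam / 2))"
  have "J Q1 Q2 lam f v = (\<Sum>\<^sub>\<infinity>m\<in>{m. m \<noteq> 0}. f (\<phi> m) / ?d m)"
    by (simp add: J_def v \<phi>_def)
  also have "\<dots> = (\<Sum>\<^sub>\<infinity>m\<in>M. f (\<phi> m) / ?d m)"
    by (rule infsum_cong_neutral) (auto simp: M_def)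
  also have "\<dots> = (\<Sum>m\<in>M. f (\<phi> m) / ?d m)" using finM by simp
  finally have "norm (J Q1 Q2 lam f v) \<le> (\<Sum>m\<in>M. norm (f (\<phi> m) / ?d m))" by (simp add: norm_sum)
  also have "\<dots> = (\<Sum>m\<in>M. J_kernel Q1 Q2 lam v (\<phi> m) * norm (f (\<phi> m)))"
    by (intro sum.cong refl) (simp add: M_def J_kernel_def v \<phi>_def norm_divide)
  also have "\<dots> = (\<Sum>w\<in>\<phi> ` M. J_kernel Q1 Q2 lam v w * norm (f w))"
    using inj by (subst sum.reindex) (auto intro: inj_on_subset)
  also have "\<dots> \<le> (\<Sum>w\<in>?S. J_kernel Q1 Q2 lam v w * norm (f w))"
    using assms sub by (intro sum_mono2) (auto simp: J_kernel_nonneg)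
  finally show ?thesis .
qed

lemma dyadic_size:
  fixes m :: "int ^ 'k::finite"
  assumes "m \<noteq> 0"
  shows "\<exists>j::nat. m \<in> box (2 ^ (j + 1)) \<and> (\<exists>i. 2 ^ j \<le> \<bar>m $ i\<bar>)"
proof -
  define R where "R = Max (range (\<lambda>i. \<bar>m $ i\<bar>))"
  have R: "\<bar>m $ i\<bar> \<le> R" for i unfolding R_def by (rule Max_ge) auto
  have "R \<in> range (\<lambda>i. \<bar>m $ i\<bar>)" unfolding R_def by (rule Max_in) auto
  then obtain i0 where i0: "R = \<bar>m $ i0\<bar>" by auto
  obtain i1 where "m $ i1 \<noteq> 0" using assms by (auto simp: vec_eq_iff)
  then have R1: "R \<ge> 1" using R[of i1] by linarith
  have "1 \<le> nat R" using R1 by simp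
  from ex_power_ivl1[OF _ this, of 2] obtain j where j: "2 ^ j \<le> nat R" "nat R < 2 ^ (j + 1)" by auto
  have j': "2 ^ j \<le> R" "R \<le> 2 ^ (j + 1)"
    using j R1 of_nat_le_iff[of "2 ^ j" "nat R", where 'a = int]
      of_nat_less_iff[of "nat R" "2 ^ (j + 1)", where 'a = int] by simp_all
  then have "m \<in> box (2 ^ (j + 1))" using R unfolding box_def by (auto intro: order_trans)
  then show ?thesis using i0 j'(1) by auto
qed

text \<open>
  At the scale \<open>|m| \<approx> 2\<^sup>j\<close> the kernel is \<open>O(2 powr (- k \<lambda> j))\<close> by positive definiteness of \<open>Q\<^sub>2\<close>, while the
  incidences contribute \<open>2 powr (\<mu> j)\<close> with some \<open>\<mu> < k \<lambda>\<close>, which sums over \<open>j\<close>.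
\<close>

lemma J_kernel_restricted_bound:
  fixes Q1 Q2 :: "int ^ 'k ^ 'k::finite"
  defines "k \<equiv> real CARD('k)"
  assumes "pos_def_form Q1" "pos_def_form Q2" "lam > 0"
    and xz: "0 \<le> x" "x \<le> 1" "0 \<le> z" "z \<le> 1" "1 \<le> x + z"
    and ex: "1 - x < lam" "1 - z < lam" "k - (k + 2) * (x + z - 1) < k * lam"
  shows "\<exists>C>0. \<forall>E F. finite E \<longrightarrow> finite F \<longrightarrow>
     (\<Sum>v\<in>F. \<Sum>w\<in>E. J_kernel Q1 Q2 lam v w) \<le> C * real (card E) powr x * real (card F) powr z"
proof -
  have k: "k > 0" by (simp add: k_def)
  obtain \<mu> where \<mu>: "Max {k * (1 - x), k * (1 - z), k - (k + 2) * (x + z - 1)} < \<mu>" "\<mu> < k * lam"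
    using dense[of "Max {k * (1 - x), k * (1 - z), k - (k + 2) * (x + z - 1)}" "k * lam"] ex k
    by (auto simp: Max_less_iff)
  then have \<mu>3: "k * (1 - x) < \<mu>" "k * (1 - z) < \<mu>" "k - (k + 2) * (x + z - 1) < \<mu>" by simp_all
  obtain C where C: "C > 0" and incidences: "\<forall>N\<ge>1. \<forall>E F. finite E \<longrightarrow> finite F \<longrightarrow>
     real (incidences Q1 N E F) \<le> C * real N powr \<mu> * real (card E) powr x * real (card F) powr z"
    using incidences_restricted_bound[OF assms(2) xz \<mu>3[unfolded k_def]] by (elim exE conjE) (rule that)
  obtain c where c: "c > 0" "\<And>m i. c * real_of_int (m $ i) ^ 2 \<le> real_of_int (quad_form Q2 m)"
    using pos_def_form_lower_bound[OF assms(3)] by blast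
  define c' where "c' = c powr (- (k * lam / 2))"
  have c': "c' > 0" using c by (simp add: c'_def)
  define r where "r = 2 powr (\<mu> - k * lam)"
  have r: "0 \<le> r" "r < 1" using \<mu>(2) unfolding r_def by (simp_all add: powr_less_one)
  define C' where "C' = c' * C * 2 powr \<mu> * (1 / (1 - r))"
  have "(\<Sum>v\<in>F. \<Sum>w\<in>E. J_kernel Q1 Q2 lam v w) \<le> C' * real (card E) powr x * real (card F) powr z"
    if E: "finite E" and F: "finite F" for E F
  proof -
    let ?ok = "\<lambda>j v w. fst v - fst w \<in> box (int (2 ^ (j + 1))) \<and> snd v - snd w = quad_form Q1 (fst v - fst w)"
    have "\<forall>v w. \<exists>j::nat. J_kernel Q1 Q2 lam v w \<le> c' * 2 powr (- (k * lam) * real j) * of_bool (?ok j v w)"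
    proof (intro allI)
      fix v w
      show "\<exists>j::nat. J_kernel Q1 Q2 lam v w \<le> c' * 2 powr (- (k * lam) * real j) * of_bool (?ok j v w)"
      proof (cases "fst v \<noteq> fst w \<and> snd v - snd w = quad_form Q1 (fst v - fst w)")
        case False
        then have "J_kernel Q1 Q2 lam v w = 0" unfolding J_kernel_def by (simp only: if_False)
        then show ?thesis using c' by simp
      next
        case True
        let ?m = "fst v - fst w"
        have "?m \<noteq> 0" using True by simp
        then obtain j i where j: "?m \<in> box (2 ^ (j + 1))" "2 ^ j \<le> \<bar>?m $ i\<bar>" using dyadic_size by blast
        have "(2 ^ j :: real) = real_of_int (2 ^ j)" by simp
        also have "\<dots> \<le> real_of_int \<bar>?m $ i\<bar>" using j(2) by (subst of_int_le_iff)
        finally have "(2 ^ j :: real) ^ 2 \<le> real_of_int \<bar>?m $ i\<bar> ^ 2" by (intro power_mono) auto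
        then have "c * (2 ^ j) ^ 2 \<le> c * real_of_int (?m $ i) ^ 2" using c(1) by simp
        also have "\<dots> \<le> real_of_int (quad_form Q2 ?m)" by (rule c(2))
        finally have q: "c * (2 ^ j) ^ 2 \<le> real_of_int (quad_form Q2 ?m)" .
        have "(c * (2 ^ j) ^ 2) powr (k * lam / 2) \<le> real_of_int (quad_form Q2 ?m) powr (k * lam / 2)"
          using q c(1) k \<open>lam > 0\<close> by (intro powr_mono2) auto
        then have "1 / real_of_int (quad_form Q2 ?m) powr (k * lam / 2) \<le> 1 / (c * (2 ^ j) ^ 2) powr (k * lam / 2)"
          using c(1) by (intro divide_left_mono) (auto intro!: mult_pos_pos less_le_trans[OF _ q])
        also have "\<dots> = c' * 2 powr (- (k * lam) * real j)"
        proof -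
          have "((2 ^ j :: real) ^ 2) = 2 powr (2 * real j)"
            by (simp add: powr_realpow[symmetric] powr_powr mult.commute flip: power_mult)
          then have "(c * (2 ^ j) ^ 2) powr (k * lam / 2) = c powr (k * lam / 2) * 2 powr (k * lam * real j)"
            using c(1) by (simp add: powr_mult powr_powr mult_ac)
          moreover have "c' = inverse (c powr (k * lam / 2))" unfolding c'_def by (rule powr_minus)
          moreover have "2 powr (- (k * lam) * real j) = inverse (2 powr (k * lam * real j))"
            unfolding mult_minus_left by (rule powr_minus)
          ultimately show ?thesis by (simp only: inverse_eq_divide inverse_mult_distrib) simp
        qed
        finally have "J_kernel Q1 Q2 lam v w \<le> c' * 2 powr (- (k * lam) * real j)"
          using True by (simp add: J_kernel_def k_def)
        moreover have "?ok j v w" using j(1) True by simp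
        ultimately show ?thesis by (intro exI[of _ j]) simp
      qed
    qed
    then obtain j :: "(int ^ 'k) \<times> int \<Rightarrow> (int ^ 'k) \<times> int \<Rightarrow> nat" where
      j: "\<And>v w. J_kernel Q1 Q2 lam v w \<le> c' * 2 powr (- (k * lam) * real (j v w)) * of_bool (?ok (j v w) v w)"
      by metis
    define l where "l = Suc (\<Sum>v\<in>F. \<Sum>w\<in>E. j v w)"
    have jl: "j v w < l" if "v \<in> F" "w \<in> E" for v w
    proof -
      have "j v w \<le> (\<Sum>w\<in>E. j v w)" using that E by (intro member_le_sum) auto
      also have "\<dots> \<le> (\<Sum>v\<in>F. \<Sum>w\<in>E. j v w)"
        using that F by (intro member_le_sum[of v F "\<lambda>v. \<Sum>w\<in>E. j v w"]) auto
      finally show ?thesis by (simp add: l_def)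
    qed
    let ?t = "\<lambda>i v w. c' * 2 powr (- (k * lam) * real i) * of_bool (?ok i v w)"
    have "(\<Sum>v\<in>F. \<Sum>w\<in>E. J_kernel Q1 Q2 lam v w) \<le> (\<Sum>v\<in>F. \<Sum>w\<in>E. \<Sum>i<l. ?t i v w)"
    proof (intro sum_mono)
      fix v w assume vw: "v \<in> F" "w \<in> E"
      have "J_kernel Q1 Q2 lam v w \<le> ?t (j v w) v w" by (rule j)
      also have "\<dots> \<le> (\<Sum>i<l. ?t i v w)"
        by (rule member_le_sum[of "j v w" "{..<l}" "\<lambda>i. ?t i v w"]) (use jl[OF vw] c' in auto)
      finally show "J_kernel Q1 Q2 lam v w \<le> (\<Sum>i<l. ?t i v w)" .
    qed
    also have "\<dots> = (\<Sum>v\<in>F. \<Sum>i<l. \<Sum>w\<in>E. ?t i v w)" by (intro sum.cong refl sum.swap)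
    also have "\<dots> = (\<Sum>i<l. \<Sum>v\<in>F. \<Sum>w\<in>E. ?t i v w)" by (rule sum.swap)
    also have "\<dots> = (\<Sum>i<l. c' * 2 powr (- (k * lam) * real i) * real (incidences Q1 (2 ^ (i + 1)) E F))"
    proof (intro sum.cong refl)
      fix i
      have "(\<Sum>v\<in>F. \<Sum>w\<in>E. of_bool (?ok i v w) :: real) = (\<Sum>u\<in>F \<times> E. of_bool (?ok i (fst u) (snd u)))"
        by (simp only: sum.cartesian_product case_prod_unfold)
      also have "\<dots> = real (card {u\<in>F \<times> E. ?ok i (fst u) (snd u)})"
        using E F by (simp add: Int_def)
      also have "{u\<in>F \<times> E. ?ok i (fst u) (snd u)} = {(v, w) \<in> F \<times> E. ?ok i v w}" by auto
      finally have "(\<Sum>v\<in>F. \<Sum>w\<in>E. of_bool (?ok i v w) :: real) = real (incidences Q1 (2 ^ (i + 1)) E F)"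
        unfolding incidences_def .
      then show "(\<Sum>v\<in>F. \<Sum>w\<in>E. ?t i v w) = c' * 2 powr (- (k * lam) * real i) * real (incidences Q1 (2 ^ (i + 1)) E F)"
        by (simp only: sum_distrib_left[symmetric])
    qed
    also have "\<dots> \<le> (\<Sum>i<l. c' * 2 powr (- (k * lam) * real i) *
        (C * real (2 ^ (i + 1)) powr \<mu> * real (card E) powr x * real (card F) powr z))"
      using E F c' by (intro sum_mono mult_left_mono incidences[rule_format]) auto
    also have "\<dots> = (\<Sum>i<l. c' * C * 2 powr \<mu> * (real (card E) powr x * real (card F) powr z) * r ^ i)"
    proof (intro sum.cong refl)
      fix i
      have "real (2 ^ (i + 1)) = 2 powr (real i + 1)" by (simp add: powr_add powr_realpow)
      then have "real (2 ^ (i + 1)) powr \<mu> = 2 powr (\<mu> * real i) * 2 powr \<mu>"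
        by (simp add: powr_powr powr_add[symmetric] algebra_simps)
      moreover have "r ^ i = 2 powr (- (k * lam) * real i) * 2 powr (\<mu> * real i)"
      proof -
        have "r ^ i = r powr real i" using r_def by (simp add: powr_realpow)
        then show ?thesis by (simp add: r_def powr_powr powr_add[symmetric] algebra_simps)
      qed
      ultimately show "c' * 2 powr (- (k * lam) * real i) *
          (C * real (2 ^ (i + 1)) powr \<mu> * real (card E) powr x * real (card F) powr z)
        = c' * C * 2 powr \<mu> * (real (card E) powr x * real (card F) powr z) * r ^ i"
        by (simp only: mult_ac)
    qed
    also have "\<dots> = c' * C * 2 powr \<mu> * (real (card E) powr x * real (card F) powr z) * (\<Sum>i<l. r ^ i)"
      by (simp only: sum_distrib_left)
    also have "\<dots> \<le> c' * C * 2 powr \<mu> * (real (card E) powr x * real (card F) powr z) * (1 / (1 - r))"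
      using c' C by (intro mult_left_mono geometric_sum_bound r) auto
    finally show ?thesis by (simp only: C'_def mult_ac)
  qed
  moreover have "C' > 0" using c' C r by (simp add: C'_def)
  ultimately show ?thesis by blast
qed

theorem corollary1p1:
  fixes Q1 Q2 :: "int ^ 'k::finite ^ 'k" and lam :: real and p q :: ereal
  assumes "CARD('k) \<ge> 3"
    and "pos_def_form Q1" and "pos_def_form Q2"
    and "0 < lam" and "lam \<le> real CARD('k) / (2 * real CARD('k) + 2)"
    and "1 \<le> p" and "1 \<le> q"
    and "real_of_ereal (1 / q) <
           real_of_ereal (1 / p) - (1 - (real CARD('k) + 2) / real CARD('k) * lam)"
    and "real_of_ereal (1 / q) < lam" and "real_of_ereal (1 / p) > 1 - lam"
  shows "extends_to_bounded p q (J Q1 Q2 lam)"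
proof -
  define k where "k = real CARD('k)"
  define X where "X = real_of_ereal (1 / p)"
  define Y where "Y = real_of_ereal (1 / q)"
  define c where "c = 1 - (k + 2) / k * lam"
  have k: "k \<ge> 3" using assms(1) by (simp add: k_def)
  have lamk: "(2 * k + 2) * lam \<le> k"
    using assms(5) k by (simp add: k_def[symmetric] field_simps)
  have X1: "X \<le> 1" using assms(6) unfolding X_def by (cases p) (auto simp: one_ereal_def)
  have Y0: "Y \<ge> 0" using assms(7) unfolding Y_def by (cases q) (auto simp: one_ereal_def)
  have XY: "Y < X - c" "Y < lam" "X > 1 - lam"
    using assms(8-10) by (simp_all add: X_def Y_def c_def k_def)
  have lam1: "lam \<le> 1 / 2"
  proof -
    have "2 * k * lam \<le> (2 * k + 2) * lam" using assms(4) by (intro mult_right_mono) auto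
    then have "k * (2 * lam) \<le> k * 1" using lamk by (simp add: mult_ac)
    then show ?thesis using k by (simp only: mult_le_cancel_left_pos) 
  qed
  have kc: "k * c = k - (k + 2) * lam" using k by (simp add: c_def field_simps)
  have c0: "c \<ge> 0"
  proof -
    have "(k + 2) * lam \<le> (2 * k + 2) * lam" using assms(4) k by (intro mult_right_mono) auto
    then have "k * c \<ge> 0" using lamk kc by linarith
    then show ?thesis using k by (simp add: zero_le_mult_iff)
  qed
  \<comment> \<open>After multiplication by \<open>k\<close> this is equivalent to \<open>\<lambda> \<le> k/(2k+2)\<close>.\<close>
  have scal: "k - (k + 2) * c \<le> k * lam"
  proof -
    have "k * (k - (k + 2) * c) = k * k - (k + 2) * (k * c)" by (simp add: algebra_simps)
    also have "\<dots> = (4 * k + 4) * lam - 2 * k + k * (k * lam)" unfolding kc by (simp add: algebra_simps)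
    also have "\<dots> \<le> k * (k * lam)" using lamk by (simp add: algebra_simps)
    finally show ?thesis using k by (simp add: mult_le_cancel_left_pos)
  qed
  \<comment> \<open>A margin by which both exponents can be moved while keeping all strict inequalities.\<close>
  define \<eta> where "\<eta> = Min {X - (1 - lam), lam - Y, X - c - Y} / 3"
  have "Min {X - (1 - lam), lam - Y, X - c - Y} > 0" using XY by (subst Min_gr_iff) auto
  moreover have "Min {X - (1 - lam), lam - Y, X - c - Y} \<le> X - (1 - lam)"
    "Min {X - (1 - lam), lam - Y, X - c - Y} \<le> lam - Y"
    "Min {X - (1 - lam), lam - Y, X - c - Y} \<le> X - c - Y" by (rule Min_le; simp)+
  ultimately have \<eta>: "\<eta> > 0" "\<eta> < X - (1 - lam)" "\<eta> < lam - Y" "2 * \<eta> < X - c - Y"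
    unfolding \<eta>_def by linarith+
  define x where "x = X - \<eta>"
  define z where "z = 1 - (Y + \<eta>)"
  have xz: "0 \<le> x" "x \<le> 1" "0 \<le> z" "z \<le> 1" "1 \<le> x + z"
    using X1 Y0 \<eta> lam1 c0 by (auto simp: x_def z_def)
  have sc: "k - (k + 2) * (x + z - 1) < k * lam"
  proof -
    have "c < x + z - 1" using \<eta> by (simp add: x_def z_def)
    then have "(k + 2) * c < (k + 2) * (x + z - 1)" using k by (intro mult_strict_left_mono) auto
    then show ?thesis using scal by linarith
  qed
  obtain C where C: "C > 0" and ker: "\<forall>E F. finite E \<longrightarrow> finite F \<longrightarrow>
     (\<Sum>v\<in>F. \<Sum>w\<in>E. J_kernel Q1 Q2 lam v w) \<le> C * real (card E) powr x * real (card F) powr z"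
    using J_kernel_restricted_bound[OF assms(2,3,4) xz _ _ sc[unfolded k_def]] \<eta>
    unfolding x_def z_def by force
  show ?thesis
  proof (rule extends_to_bounded_if_restricted_bound)
    show "(\<Sum>v\<in>F. \<Sum>w\<in>E. J_kernel Q1 Q2 lam v w) \<le> C * real (card E) powr x * real (card F) powr z"
      if "finite E" "finite F" for E F using ker that by blast
    show "norm (J Q1 Q2 lam f v) \<le> (\<Sum>w\<in>{w. f w \<noteq> 0}. J_kernel Q1 Q2 lam v w * norm (f w))"
      if "finite {w. f w \<noteq> 0}" for f v using that by (rule norm_J_le)
    show "x < real_of_ereal (1 / p)" using \<eta> by (simp add: x_def X_def)
    show "z < 1" "real_of_ereal (1 / q) < 1 - z" using \<eta> Y0 by (simp_all add: z_def Y_def)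
  qed (use C assms xz in \<open>auto simp: J_kernel_nonneg\<close>)
qed

end
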